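(* Let $X(\mathbb{R}^n)$ be a Banach function space. Then $\mathcal{M}_{X(\mathbb{R}^n)}\cap L^\infty(\mathbb{R}^n)$ is a normed algebra with respect to the norm $\|\cdot\|_{\mathcal{M}_{X(\mathbb{R}^n)}}$ (under pointwise multiplication), and \[ \|ab\|_{\mathcal{M}_{X(\mathbb{R}^n)}}\le\|a\|_{\mathcal{M}_{X(\mathbb{R}^n)}}\|b\|_{\mathcal{M}_{X(\mathbb{R}^n)}}\quad\text{for all } a,b\in\mathcal{M}_{X(\mathbb{R}^n)}\cap L^\infty(\mathbb{R}^n). \]
   Context: Banach function spaces: let $\mathfrak{M}^+(\mathbb{R}^n)$ be the set of measurable functions with values in $[0,\infty]$. A Banach function norm $\rho:\mathfrak{M}^+\to[0,\infty]$ satisfies, for all $f,g,f_j\in\mathfrak{M}^+$, $a\ge0$, measurable $E$: (A1) $\rho(f)=0\iff f=0$ a.e., $\rho(af)=a\rho(f)$, $\rho(f+g)\le\rho(f)+\rho(g)$; (A2) $0\le g\le f$ a.e. implies $\rho(g)\le\rho(f)$; (A3) $0\le f_j\uparrow f$ a.e. implies $\rho(f_j)\uparrow\rho(f)$; (A4) $|E|<\infty$ implies $\rho(\chi_E)<\infty$; (A5) $|E|<\infty$ implies $\int_Ef\le C_E\rho(f)$ with $C_E$ independent of $f$. $X(\mathbb{R}^n)$ is the set of measurable complex $f$ with $\rho(|f|)<\infty$, $\|f\|_X=\rho(|f|)$. Fourier transform: $(Fu)(\xi)=\int u(x)e^{-ix\xi}dx$, extended to $S'(\mathbb{R}^n)$.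 $\mathcal{M}_{X(\mathbb{R}^n)}$ is the set of $a\in S'(\mathbb{R}^n)$ with $\|a\|_{\mathcal{M}_X}:=\sup\{\|F^{-1}aFu\|_{X}/\|u\|_{X}: u\in (S(\mathbb{R}^n)\cap X)\setminus\{0\}\}<\infty$. *)

theory Defs
  imports "HOL-Analysis.Analysis"
begin

definition nonneg_meas :: "(real ^ 'n \<Rightarrow> ennreal) set" where
  "nonneg_meas = borel_measurable lebesgue"

definition banach_function_norm :: "((real ^ 'n \<Rightarrow> ennreal) \<Rightarrow> ennreal) \<Rightarrow> bool" where
  "banach_function_norm \<rho> \<longleftrightarrow>
     \<comment> \<open>(A1)\<close>
     (\<forall>f\<in>nonneg_meas. \<rho> f = 0 \<longleftrightarrow> (AE x in lebesgue. f x = 0)) \<and>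
     (\<forall>f\<in>nonneg_meas. \<forall>a::real. a \<ge> 0 \<longrightarrow> \<rho> (\<lambda>x. ennreal a * f x) = ennreal a * \<rho> f) \<and>
     (\<forall>f\<in>nonneg_meas. \<forall>g\<in>nonneg_meas. \<rho> (\<lambda>x. f x + g x) \<le> \<rho> f + \<rho> g) \<and>
     \<comment> \<open>(A2)\<close>
     (\<forall>f\<in>nonneg_meas. \<forall>g\<in>nonneg_meas. (AE x in lebesgue. g x \<le> f x) \<longrightarrow> \<rho> g \<le> \<rho> f) \<and>
     \<comment> \<open>(A3)\<close>
     (\<forall>F f. (\<forall>j. F j \<in> nonneg_meas) \<longrightarrow> f \<in> nonneg_meas \<longrightarrow>
        (AE x in lebesgue. incseq (\<lambda>j. F j x) \<and> (\<lambda>j. F j x) \<longlonglongrightarrow> f x) \<longrightarrow>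
        incseq (\<lambda>j. \<rho> (F j)) \<and> (\<lambda>j. \<rho> (F j)) \<longlonglongrightarrow> \<rho> f) \<and>
     \<comment> \<open>(A4)\<close>
     (\<forall>E\<in>sets lebesgue. emeasure lebesgue E < \<infinity> \<longrightarrow> \<rho> (indicator E) < \<infinity>) \<and>
     \<comment> \<open>(A5)\<close>
     (\<forall>E\<in>sets lebesgue. emeasure lebesgue E < \<infinity> \<longrightarrow>
        (\<exists>C::real. \<forall>f\<in>nonneg_meas. (\<integral>\<^sup>+ x\<in>E. f x \<partial>lebesgue) \<le> ennreal C * \<rho> f))"

definition bfs :: "((real ^ 'n \<Rightarrow> ennreal) \<Rightarrow> ennreal) \<Rightarrow> (real ^ 'n \<Rightarrow> complex) set" where
  "bfs \<rho> = {f. f \<in> borel_measurable lebesgue \<and> \<rho> (\<lambda>x. ennreal (cmod (f x))) < \<infinity>}"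

definition bfs_norm :: "((real ^ 'n \<Rightarrow> ennreal) \<Rightarrow> ennreal) \<Rightarrow> (real ^ 'n \<Rightarrow> complex) \<Rightarrow> real" where
  "bfs_norm \<rho> f = enn2real (\<rho> (\<lambda>x. ennreal (cmod (f x))))"

fun pderivs :: "(real ^ 'n) list \<Rightarrow> (real ^ 'n \<Rightarrow> complex) \<Rightarrow> (real ^ 'n \<Rightarrow> complex)" where
  "pderivs [] f = f"
| "pderivs (v # vs) f = (\<lambda>x. vector_derivative (\<lambda>t::real. pderivs vs f (x + t *\<^sub>R v)) (at 0))"

definition schwartz :: "(real ^ 'n \<Rightarrow> complex) \<Rightarrow> bool" where
  "schwartz f \<longleftrightarrow>
     (\<forall>vs. set vs \<subseteq> Basis \<longrightarrow> (\<forall>x. pderivs vs f differentiable (at x))) \<and>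
     (\<forall>vs (m::nat). set vs \<subseteq> Basis \<longrightarrow>
        bounded (range (\<lambda>x. (1 + norm x) ^ m * cmod (pderivs vs f x))))"

definition fourier :: "(real ^ 'n \<Rightarrow> complex) \<Rightarrow> (real ^ 'n \<Rightarrow> complex)" where
  "fourier u = (\<lambda>\<xi>. \<integral>x. u x * cis (- (x \<bullet> \<xi>)) \<partial>lebesgue)"

definition inv_fourier :: "(real ^ 'n \<Rightarrow> complex) \<Rightarrow> (real ^ 'n \<Rightarrow> complex)" where
  "inv_fourier g = (\<lambda>x. complex_of_real ((2 * pi) powr (- real CARD('n))) *
                        (\<integral>\<xi>. g \<xi> * cis (x \<bullet> \<xi>) \<partial>lebesgue))"

definition Linf :: "(real ^ 'n \<Rightarrow> complex) set" where
  "Linf = {a. a \<in> borel_measurable lebesgue \<and> (\<exists>C. AE \<xi> in lebesgue. cmod (a \<xi>) \<le> C)}"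

text \<open>Multiplier norm as extended value (sup over u in (S \<inter> X) minus 0 of
  rho|F^{-1} a F u| / rho|u|), the multiplier class M_X, and the real-valued norm.
  For a in L^\<infinity> the operator F^{-1} a F u coincides with the distributional one.\<close>
definition mult_norm_enn :: "((real ^ 'n \<Rightarrow> ennreal) \<Rightarrow> ennreal) \<Rightarrow> (real ^ 'n \<Rightarrow> complex) \<Rightarrow> ennreal" where
  "mult_norm_enn \<rho> a =
     (SUP u\<in>{u. schwartz u \<and> u \<in> bfs \<rho> \<and> u \<noteq> (\<lambda>x. 0)}.
        \<rho> (\<lambda>x. ennreal (cmod (inv_fourier (\<lambda>\<xi>. a \<xi> * fourier u \<xi>) x)))
          / \<rho> (\<lambda>x. ennreal (cmod (u x))))"

definition multipliers :: "((real ^ 'n \<Rightarrow> ennreal) \<Rightarrow> ennreal) \<Rightarrow> (real ^ 'n \<Rightarrow> complex) set" where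
  "multipliers \<rho> = {a. mult_norm_enn \<rho> a < \<infinity>}"

definition mult_norm :: "((real ^ 'n \<Rightarrow> ennreal) \<Rightarrow> ennreal) \<Rightarrow> (real ^ 'n \<Rightarrow> complex) \<Rightarrow> real" where
  "mult_norm \<rho> a = enn2real (mult_norm_enn \<rho> a)"

end

(* If v = F^{-1}(b F u) with u Schwartz, then v need not be Schwartz, so the multiplier bound for a does
   not apply to it directly. But b F u has all moments, hence v is smooth with bounded derivatives, and
   v_k(x) = v(x) exp(-(e_k |x|)^2/2) with e_k -> 0 is Schwartz with |v_k| <= |v|; thus v_k lies in X with
   norm at most that of v. Since F v_k is the convolution of b F u with a Gaussian approximate identity,
   it tends to b F u in L^1, so F^{-1}(a F v_k) tends pointwise to F^{-1}(a b F u), and the Fatou property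
   (A3) gives submultiplicativity. The same approximate identity shows that F^{-1} is injective on L^1;
   definiteness follows by testing with modulated bump functions, which lie in X by (A2) and (A4) and whose
   Fourier transforms do not vanish on balls of a fixed radius around arbitrary centres. *)

theory Submission
  imports Defs "HOL-Probability.Characteristic_Functions" "HOL-Probability.Sinc_Integral"
begin

section \<open>Translations and approximate identities in $L^1$\<close>

text \<open>Multiplication by a merely bounded measurable \<open>b\<close> may destroy the
  smoothness of \<open>fourier u\<close>, so the inverse transform keeps its derivatives but loses
  decay; a factor decaying in the space variable has to restore it. The Gaussian serves because its
  transform is again an explicit Gaussian, nonnegative and of integral one after scaling: the
  regularised transform is then an average of translates, and continuity of translation in L1 is all
  that is needed. The identity behind this is a plain Fubini computation, asks for no integrability
  of the transform, and takes the place of an inversion theorem. Membership in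
  \<open>schwartz\<close> concerns all iterated partial derivatives. It is obtained from families
  closed under differentiation up to coordinate factors, once for the Gaussian regularisations and
  once for the bumps. The transform of a single bump may have zeros, so definiteness uses
  modulations, which move one neighbourhood of non-vanishing to every frequency. Symbols are only
  Lebesgue measurable, while Fubini is used for Borel functions; hence the estimates are proved for
  bounded Borel representatives and transferred.\<close>

lemma integrable_lborel_affine:
  fixes f :: "'a::euclidean_space \<Rightarrow> 'b::{banach, second_countable_topology}"
  assumes f: "integrable lborel f" and c: "c \<noteq> 0"
  shows "integrable lborel (\<lambda>x. f (t + c *\<^sub>R x))"
proof -
  have m: "f \<in> borel_measurable borel" using f by auto
  have "integrable (density (distr lborel borel (\<lambda>x. t + c *\<^sub>R x)) (\<lambda>_. ennreal (\<bar>c\<bar>^DIM('a)))) f"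
    using f lborel_affine[OF c, of t] by simp
  then have "integrable (distr lborel borel (\<lambda>x. t + c *\<^sub>R x)) (\<lambda>x. \<bar>c\<bar>^DIM('a) *\<^sub>R f x)"
    by (subst (asm) integrable_density) (use m in auto)
  then have "integrable lborel (\<lambda>x. \<bar>c\<bar>^DIM('a) *\<^sub>R f (t + c *\<^sub>R x))"
    by (subst (asm) integrable_distr_eq) (use m in auto)
  then have "integrable lborel (\<lambda>x. (1 / \<bar>c\<bar>^DIM('a)) *\<^sub>R (\<bar>c\<bar>^DIM('a) *\<^sub>R f (t + c *\<^sub>R x)))"
    by (rule integrable_scaleR_right)
  then show ?thesis using c by simp
qed

lemma integral_lborel_affine:
  fixes f :: "'a::euclidean_space \<Rightarrow> 'b::{banach, second_countable_topology}"
  assumes m[measurable]: "f \<in> borel_measurable borel" and c: "c \<noteq> 0"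
  shows "(\<integral>x. f x \<partial>lborel) = \<bar>c\<bar>^DIM('a) *\<^sub>R (\<integral>x. f (t + c *\<^sub>R x) \<partial>lborel)"
proof -
  have "(\<integral>x. f x \<partial>lborel) = (\<integral>x. f x \<partial>density (distr lborel borel (\<lambda>x. t + c *\<^sub>R x)) (\<lambda>_. ennreal (\<bar>c\<bar>^DIM('a))))"
    using lborel_affine[OF c, of t] by simp
  also have "\<dots> = (\<integral>x. \<bar>c\<bar>^DIM('a) *\<^sub>R f x \<partial>distr lborel borel (\<lambda>x. t + c *\<^sub>R x))"
    by (subst integral_density) auto
  also have "\<dots> = (\<integral>x. \<bar>c\<bar>^DIM('a) *\<^sub>R f (t + c *\<^sub>R x) \<partial>lborel)"
    by (subst integral_distr) auto
  finally show ?thesis by simp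
qed

lemma integrable_lborel_translate:
  fixes f :: "'a::euclidean_space \<Rightarrow> 'b::{banach, second_countable_topology}"
  assumes f: "integrable lborel f"
  shows "integrable lborel (\<lambda>x. f (x + t))"
  using integrable_lborel_affine[OF f, of 1 t] by (simp add: add.commute)

lemma integral_lborel_translate:
  fixes f :: "'a::euclidean_space \<Rightarrow> 'b::{banach, second_countable_topology}"
  assumes f: "f \<in> borel_measurable borel"
  shows "(\<integral>x. f (x + t) \<partial>lborel) = (\<integral>x. f x \<partial>lborel)"
  using integral_lborel_affine[OF f, of 1 t] by (simp add: add.commute)

text \<open>\<open>lborel\<close> is the image of the product of one-dimensional Lebesgue measures
  under the coordinate map. This reduces the Gaussian integrals and the integrable majorant below to
  one variable.\<close>

lemma integrable_lborel_prod_Basis: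
  fixes f :: "'a::euclidean_space \<Rightarrow> real \<Rightarrow> 'b::{real_normed_field,banach,second_countable_topology}"
  assumes f: "\<And>b. b \<in> Basis \<Longrightarrow> integrable lborel (f b)"
  shows "integrable lborel (\<lambda>x::'a. \<Prod>b\<in>Basis. f b (x \<bullet> b))"
    and "(\<integral>x. (\<Prod>b\<in>Basis. f b (x \<bullet> b)) \<partial>(lborel::'a measure)) = (\<Prod>b\<in>Basis. (\<integral>x. f b x \<partial>lborel))"
proof -
  interpret product_sigma_finite "\<lambda>b::'a. lborel::real measure"
    by standard
  have m[measurable]: "f b \<in> borel_measurable borel" if "b \<in> Basis" for b
    using f[OF that] by auto
  have bm: "(\<lambda>x::'a. \<Prod>b\<in>Basis. f b (x \<bullet> b)) \<in> borel_measurable borel"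
    by measurable
  have eq: "(\<Prod>b\<in>Basis. f b ((\<Sum>i\<in>Basis. g i *\<^sub>R i) \<bullet> b)) = (\<Prod>b\<in>Basis. f b (g b))" for g :: "'a \<Rightarrow> real"
    by (intro prod.cong refl) simp
  have T: "(\<lambda>f. \<Sum>b\<in>Basis. f b *\<^sub>R b) \<in> measurable (\<Pi>\<^sub>M b\<in>Basis. lborel::real measure) (borel::'a measure)"
    by measurable
  show "integrable lborel (\<lambda>x::'a. \<Prod>b\<in>Basis. f b (x \<bullet> b))"
    using product_integrable_prod[OF finite_Basis f]
    by (subst lborel_eq, subst integrable_distr_eq[OF T bm]) (simp add: eq)
  show "(\<integral>x. (\<Prod>b\<in>Basis. f b (x \<bullet> b)) \<partial>(lborel::'a measure)) = (\<Prod>b\<in>Basis. (\<integral>x. f b x \<partial>lborel))"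
    using product_integral_prod[OF finite_Basis f]
    by (subst lborel_eq, subst integral_distr[OF T bm]) (simp add: eq)
qed

text \<open>A translate of \<open>U\<close> has the same measure as \<open>U\<close>, so what it
  gains equals what it loses. The loss is dominated by the indicator of \<open>U\<close>, and
  openness makes it tend to 0 at every point.\<close>

lemma tendsto_L1_translate_open:
  fixes U :: "'a::euclidean_space set" and h :: "nat \<Rightarrow> 'a"
  assumes U: "open U" "emeasure lborel U < \<infinity>" and h: "h \<longlonglongrightarrow> 0"
  shows "(\<lambda>n. \<integral>x. \<bar>indicator U (x + h n) - indicator U x\<bar> \<partial>lborel) \<longlonglongrightarrow> (0::real)"
proof -
  have [measurable]: "U \<in> sets borel" using U by auto
  have iU: "integrable lborel (indicator U :: 'a \<Rightarrow> real)"
    using U by (simp add: integrable_indicator_iff)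
  have iUh: "integrable lborel (\<lambda>x. indicator U (x + h n) :: real)" for n
    using integrable_lborel_translate[OF iU] .
  have iP: "integrable lborel (\<lambda>x. indicator U x * (1 - indicator U (x + h n)) :: real)" for n
    by (rule Bochner_Integration.integrable_bound[OF iU]) (auto simp: indicator_def)
  \<comment> \<open>Pointwise, the absolute difference is the signed difference plus twice the loss,
    and the signed difference integrates to 0.\<close>
  have eq: "(\<integral>x. \<bar>indicator U (x + h n) - indicator U x\<bar> \<partial>lborel) =
        2 * (\<integral>x. indicator U x * (1 - indicator U (x + h n)) \<partial>lborel :: real)" for n
  proof -
    have "(\<integral>x. \<bar>indicator U (x + h n) - indicator U x\<bar> \<partial>lborel :: real) =
       (\<integral>x. (indicator U (x + h n) - indicator U x) + 2 * (indicator U x * (1 - indicator U (x + h n))) \<partial>lborel)"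
      by (intro Bochner_Integration.integral_cong refl) (auto simp: indicator_def)
    also have "\<dots> = (\<integral>x. indicator U (x + h n) \<partial>lborel) - (\<integral>x. indicator U x \<partial>lborel)
        + 2 * (\<integral>x. indicator U x * (1 - indicator U (x + h n)) \<partial>lborel)"
      using iU iUh[of n] iP[of n] by (simp add: del: integral_indicator Bochner_Integration.integral_indicator)
    also have "(\<integral>x. indicator U (x + h n) \<partial>lborel :: real) = (\<integral>x. indicator U x \<partial>lborel)"
      by (rule integral_lborel_translate) auto
    finally show ?thesis by simp
  qed
  have "(\<lambda>n. \<integral>x. indicator U x * (1 - indicator U (x + h n)) \<partial>lborel) \<longlonglongrightarrow> (\<integral>x. (0::real) \<partial>(lborel::'a measure))"
  proof (rule integral_dominated_convergence[OF _ _ iU])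
    show "AE x in lborel. (\<lambda>n. indicator U x * (1 - indicator U (x + h n)) :: real) \<longlonglongrightarrow> 0"
    proof (rule AE_I2)
      fix x
      show "(\<lambda>n. indicator U x * (1 - indicator U (x + h n)) :: real) \<longlonglongrightarrow> 0"
      proof (cases "x \<in> U")
        case True
        have "(\<lambda>n. x + h n) \<longlonglongrightarrow> x" using tendsto_add[OF tendsto_const h, of x] by simp
        then have "\<forall>\<^sub>F n in sequentially. x + h n \<in> U"
          using True U(1) by (simp add: topological_tendstoD)
        then have "\<forall>\<^sub>F n in sequentially. (indicator U x * (1 - indicator U (x + h n)) :: real) = 0"
          by eventually_elim simp
        then show ?thesis by (rule tendsto_eventually)
      qed simp
    qed
  qed (auto simp: indicator_def)
  then have "(\<lambda>n. 2 * (\<integral>x. indicator U x * (1 - indicator U (x + h n)) \<partial>lborel)) \<longlonglongrightarrow> 2 * (0::real)"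
    by (intro tendsto_mult tendsto_const) simp
  then show ?thesis unfolding eq by simp
qed

text \<open>Density argument along \<open>integrable_induct\<close>: outer regularity passes from
  open sets to Borel sets, the triangle inequality handles sums, and translation invariance of the
  L1 distance lets the property survive dominated limits.\<close>

lemma tendsto_L1_translate:
  fixes g :: "'a::euclidean_space \<Rightarrow> 'b::{banach, second_countable_topology}"
  assumes g: "integrable lborel g" and h: "h \<longlonglongrightarrow> 0"
  shows "(\<lambda>n. \<integral>x. norm (g (x + h n) - g x) \<partial>lborel) \<longlonglongrightarrow> 0"
  using g
proof (induction rule: integrable_induct)
  case (base A c)
  have [measurable]: "A \<in> sets borel" using base by simp
  have "(\<lambda>n. \<integral>x. \<bar>indicator A (x + h n) - indicator A x\<bar> \<partial>lborel) \<longlonglongrightarrow> (0::real)"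
  proof (rule LIMSEQ_I)
    fix r :: real assume r: "r > 0"
    \<comment> \<open>The error \<open>U - A\<close> enters twice, once translated and once in
      place, so r/4 leaves r/2 for the open set.\<close>
    obtain U where U: "open U" "A \<subseteq> U" "emeasure lborel (U - A) < ennreal (r/4)"
      using outer_regular_lborel[of A "r/4"] r base by auto
    have [measurable]: "U \<in> sets borel" using U by auto
    have "emeasure lborel U = emeasure lborel A + emeasure lborel (U - A)"
      using U(2) by (subst plus_emeasure) (auto simp: Un_absorb1)
    then have Uf: "emeasure lborel U < \<infinity>"
      using U(3) base(2) by (auto simp: less_top[symmetric] ennreal_add_eq_top)
    have iU: "integrable lborel (indicator U :: 'a \<Rightarrow> real)"
      using Uf by (simp add: integrable_indicator_iff)
    have iA: "integrable lborel (indicator A :: 'a \<Rightarrow> real)"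
      using base by (simp add: integrable_indicator_iff)
    have iD: "integrable lborel (indicator (U - A) :: 'a \<Rightarrow> real)"
      using U(3) by (simp add: integrable_indicator_iff less_top[symmetric]) (metis ennreal_less_top order.strict_trans top.not_eq_extremum)
    have D: "(\<integral>x. indicator (U - A) x \<partial>lborel) \<le> r/4"
      using U(3) r enn2real_leI[of "r/4" "emeasure lborel (U - A)"] by (simp add: measure_def)
    obtain N where N: "\<And>n. n \<ge> N \<Longrightarrow> norm ((\<integral>x. \<bar>indicator U (x + h n) - indicator U x\<bar> \<partial>lborel) - (0::real)) < r/2"
      using LIMSEQ_D[OF tendsto_L1_translate_open[OF U(1) Uf h], of "r/2"] r by auto
    show "\<exists>no. \<forall>n\<ge>no. norm ((\<integral>x. \<bar>indicator A (x + h n) - indicator A x\<bar> \<partial>lborel) - (0::real)) < r"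
    proof (intro exI[of _ N] allI impI)
      fix n assume n: "n \<ge> N"
      have i1: "integrable lborel (\<lambda>x. \<bar>indicator U (x + h n) - indicator U x\<bar> :: real)"
        by (intro integrable_abs Bochner_Integration.integrable_diff iU integrable_lborel_translate)
      have i2: "integrable lborel (\<lambda>x. indicator (U - A) (x + h n) :: real)"
        by (intro integrable_lborel_translate iD)
      have i0: "integrable lborel (\<lambda>x. \<bar>indicator A (x + h n) - indicator A x\<bar> :: real)"
        by (intro integrable_abs Bochner_Integration.integrable_diff iA integrable_lborel_translate)
      have pw: "\<bar>indicator A (x + h n) - indicator A x\<bar> \<le>
         (\<bar>indicator U (x + h n) - indicator U x\<bar> + indicator (U - A) (x + h n) + indicator (U - A) x :: real)" for x
        using U(2) by (auto simp: indicator_def)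
      have "(\<integral>x. \<bar>indicator A (x + h n) - indicator A x :: real\<bar> \<partial>lborel) \<le>
        (\<integral>x. \<bar>indicator U (x + h n) - indicator U x\<bar> + indicator (U - A) (x + h n) + indicator (U - A) x \<partial>lborel)"
        by (intro integral_mono[OF i0 _ pw] Bochner_Integration.integrable_add i1 i2 iD)
      also have "\<dots> = (\<integral>x. \<bar>indicator U (x + h n) - indicator U x\<bar> \<partial>lborel) + (\<integral>x. indicator (U - A) (x + h n) \<partial>lborel)
          + (\<integral>x. indicator (U - A) x \<partial>lborel)"
        using i1 i2 iD by (simp del: integral_indicator Bochner_Integration.integral_indicator)
      also have "(\<integral>x. indicator (U - A) (x + h n) \<partial>lborel :: real) = (\<integral>x. indicator (U - A) x \<partial>lborel)"
        by (rule integral_lborel_translate) auto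
      finally have "(\<integral>x. \<bar>indicator A (x + h n) - indicator A x\<bar> \<partial>lborel) < r"
        using N[OF n] D by (simp add: abs_less_iff)
      moreover have "0 \<le> (\<integral>x. \<bar>indicator A (x + h n) - indicator A x\<bar> \<partial>lborel :: real)"
        by simp
      ultimately show "norm ((\<integral>x. \<bar>indicator A (x + h n) - indicator A x\<bar> \<partial>lborel) - (0::real)) < r"
        by simp
    qed
  qed
  then have "(\<lambda>n. (\<integral>x. \<bar>indicator A (x + h n) - indicator A x\<bar> \<partial>lborel) * norm c) \<longlonglongrightarrow> 0 * norm c"
    by (intro tendsto_mult tendsto_const)
  moreover have "norm (indicator A (x + h n) *\<^sub>R c - indicator A x *\<^sub>R c) =
      \<bar>indicator A (x + h n) - indicator A x\<bar> * norm c" for x n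
    by (simp flip: scaleR_diff_left)
  ultimately show ?case by simp
next
  case (add f g)
  have i: "integrable lborel (\<lambda>x. norm (k (x + h n) - k x))" if "integrable lborel k" for k :: "'a \<Rightarrow> 'b" and n
    by (intro integrable_norm Bochner_Integration.integrable_diff that integrable_lborel_translate)
  show ?case
  proof (rule tendsto_sandwich[OF _ _ tendsto_const])
    show "\<forall>\<^sub>F n in sequentially. (\<integral>x. norm (f (x + h n) + g (x + h n) - (f x + g x)) \<partial>lborel)
        \<le> (\<integral>x. norm (f (x + h n) - f x) \<partial>lborel) + (\<integral>x. norm (g (x + h n) - g x) \<partial>lborel)"
    proof (rule always_eventually, rule allI)
      fix n
      have "(\<integral>x. norm (f (x + h n) + g (x + h n) - (f x + g x)) \<partial>lborel)
        \<le> (\<integral>x. norm (f (x + h n) - f x) + norm (g (x + h n) - g x) \<partial>lborel)"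
        using i[of "\<lambda>x. f x + g x" n] i[of f n] i[of g n] add.hyps
        by (intro integral_mono) (auto simp: norm_diff_triangle_ineq)
      then show "(\<integral>x. norm (f (x + h n) + g (x + h n) - (f x + g x)) \<partial>lborel)
        \<le> (\<integral>x. norm (f (x + h n) - f x) \<partial>lborel) + (\<integral>x. norm (g (x + h n) - g x) \<partial>lborel)"
        using i[of f n] i[of g n] add.hyps by simp
    qed
    show "(\<lambda>n. (\<integral>x. norm (f (x + h n) - f x) \<partial>lborel) + (\<integral>x. norm (g (x + h n) - g x) \<partial>lborel)) \<longlonglongrightarrow> 0"
      using tendsto_add[OF add.IH] by simp
  qed auto
next
  case (lim f s)
  have i: "integrable lborel (\<lambda>x. norm (k (x + h n) - k x))" if "integrable lborel k" for k :: "'a \<Rightarrow> 'b" and n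
    by (intro integrable_norm Bochner_Integration.integrable_diff that integrable_lborel_translate)
  have id: "integrable lborel (\<lambda>x. norm (s j x - f x))" for j
    by (intro integrable_norm Bochner_Integration.integrable_diff lim.hyps)
  have conv: "(\<lambda>j. \<integral>x. norm (s j x - f x) \<partial>lborel) \<longlonglongrightarrow> (\<integral>x. (0::real) \<partial>(lborel::'a measure))"
  proof (rule integral_dominated_convergence)
    \<comment> \<open>The approximants satisfy \<open>norm (s j x) \<le> 2 * norm (f x)\<close>, and
      the subtracted \<open>f\<close> adds one more multiple.\<close>
    show "integrable lborel (\<lambda>x. 3 * norm (f x))" using lim.hyps by auto
    show "AE x in lborel. (\<lambda>j. norm (s j x - f x)) \<longlonglongrightarrow> 0"
      using lim.hyps(2) by (auto simp: LIM_zero_iff tendsto_norm_zero_iff)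
    show "AE x in lborel. norm (norm (s j x - f x)) \<le> 3 * norm (f x)" for j
    proof (rule AE_I2)
      fix x :: 'a
      have "norm (s j x - f x) \<le> norm (s j x) + norm (f x)" by (rule norm_triangle_ineq4)
      then show "norm (norm (s j x - f x)) \<le> 3 * norm (f x)" using lim.hyps(3)[of x j] by simp
    qed
  qed (use id lim.hyps in auto)
  show ?case
  proof (rule LIMSEQ_I)
    fix r :: real assume r: "r > 0"
    obtain j where j: "norm ((\<integral>x. norm (s j x - f x) \<partial>lborel) - 0) < r/4"
      using LIMSEQ_D[OF conv, of "r/4"] r by auto
    obtain N where N: "\<And>n. n \<ge> N \<Longrightarrow> norm ((\<integral>x. norm (s j (x + h n) - s j x) \<partial>lborel) - 0) < r/2"
      using LIMSEQ_D[OF lim.IH[of j], of "r/2"] r by auto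
    show "\<exists>no. \<forall>n\<ge>no. norm ((\<integral>x. norm (f (x + h n) - f x) \<partial>lborel) - 0) < r"
    proof (intro exI[of _ N] allI impI)
      fix n assume n: "n \<ge> N"
      have idh: "integrable lborel (\<lambda>x. norm (s j (x + h n) - f (x + h n)))"
        using integrable_lborel_translate[OF id] .
      have "(\<integral>x. norm (f (x + h n) - f x) \<partial>lborel) \<le>
        (\<integral>x. norm (s j (x + h n) - s j x) + norm (s j (x + h n) - f (x + h n)) + norm (s j x - f x) \<partial>lborel)"
      proof (rule integral_mono)
        fix x
        have "f (x + h n) - f x = (s j (x + h n) - s j x) - (s j (x + h n) - f (x + h n)) + (s j x - f x)"
          by simp
        also have "norm \<dots> \<le> norm ((s j (x + h n) - s j x) - (s j (x + h n) - f (x + h n))) + norm (s j x - f x)"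
          by (rule norm_triangle_ineq)
        also have "\<dots> \<le> norm (s j (x + h n) - s j x) + norm (s j (x + h n) - f (x + h n)) + norm (s j x - f x)"
          by (intro add_right_mono norm_triangle_ineq4)
        finally show "norm (f (x + h n) - f x) \<le> norm (s j (x + h n) - s j x) + norm (s j (x + h n) - f (x + h n)) + norm (s j x - f x)" .
      qed (intro i lim.hyps Bochner_Integration.integrable_add idh id)+
      also have "\<dots> = (\<integral>x. norm (s j (x + h n) - s j x) \<partial>lborel) + (\<integral>x. norm (s j (x + h n) - f (x + h n)) \<partial>lborel)
          + (\<integral>x. norm (s j x - f x) \<partial>lborel)"
        using i[OF lim.hyps(1)] idh id by simp
      also have "(\<integral>x. norm (s j (x + h n) - f (x + h n)) \<partial>lborel) = (\<integral>x. norm (s j x - f x) \<partial>lborel)"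
        using integral_lborel_translate[of "\<lambda>x. norm (s j x - f x)" "h n"] id[of j] by auto
      finally show "norm ((\<integral>x. norm (f (x + h n) - f x) \<partial>lborel) - 0) < r"
        using N[OF n] j by simp
    qed
  qed
qed

text \<open>The L1 error is at most the average of \<open>\<tau> (e n *\<^sub>R z)\<close> with
  weight \<open>G z\<close>, where \<open>\<tau>\<close> is the L1 modulus of continuity of
  \<open>g\<close>. It is bounded by twice the norm of \<open>g\<close> and tends to 0 at the
  origin, so dominated convergence applies. Scaling the shift instead of \<open>G\<close> avoids
  dividing by the scale, which may therefore be 0.\<close>

lemma tendsto_L1_approximate_identity:
  fixes g :: "'a::euclidean_space \<Rightarrow> 'b::{banach, second_countable_topology}"
  assumes g: "integrable lborel g" and G: "integrable lborel G" and G0: "\<And>z. G z \<ge> (0::real)"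
    and G1: "(\<integral>z. G z \<partial>lborel) = 1" and e: "e \<longlonglongrightarrow> (0::real)"
  shows "(\<lambda>n. \<integral>y. norm ((\<integral>z. G z *\<^sub>R g (y + e n *\<^sub>R z) \<partial>lborel) - g y) \<partial>lborel) \<longlonglongrightarrow> 0"
    and "integrable lborel (\<lambda>y. \<integral>z. G z *\<^sub>R g (y + c *\<^sub>R z) \<partial>lborel)"
proof -
  have [measurable]: "g \<in> borel_measurable borel" "G \<in> borel_measurable borel" using g G by auto
  define L where "L = (\<integral>y. norm (g y) \<partial>lborel)"
  define \<tau> where "\<tau> = (\<lambda>h. \<integral>y. norm (g (y + h) - g y) \<partial>lborel)"
  have L0: "L \<ge> 0" unfolding L_def by simp
  have \<tau>m[measurable]: "\<tau> \<in> borel_measurable borel" unfolding \<tau>_def by measurable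
  have ih: "integrable lborel (\<lambda>y. norm (g (y + h) - g y))" for h
    by (intro integrable_norm Bochner_Integration.integrable_diff g integrable_lborel_translate)
  have gh: "integrable lborel (\<lambda>y. g (y + h))" for h
    by (intro g integrable_lborel_translate)
  have L': "(\<integral>y. norm (g (y + h)) \<partial>lborel) = L" for h
    unfolding L_def by (rule integral_lborel_translate) auto
  have \<tau>le: "\<tau> h \<le> 2 * L" and \<tau>0: "\<tau> h \<ge> 0" for h
  proof -
    have "\<tau> h \<le> (\<integral>y. norm (g (y + h)) + norm (g y) \<partial>lborel)"
      unfolding \<tau>_def by (intro integral_mono ih Bochner_Integration.integrable_add integrable_norm gh g norm_triangle_ineq4)
    also have "\<dots> = 2 * L" using gh[of h] g L'[of h] by (simp add: L_def)
    finally show "\<tau> h \<le> 2 * L" .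
    show "\<tau> h \<ge> 0" unfolding \<tau>_def by simp
  qed
  \<comment> \<open>Integrating over \<open>y\<close> first makes Fubini applicable: every translate
    of \<open>g\<close> has norm \<open>L\<close>, which leaves \<open>G z * L\<close>.\<close>
  have prod1: "integrable (lborel \<Otimes>\<^sub>M lborel) (\<lambda>(z,y). G z *\<^sub>R g (y + c *\<^sub>R z))" for c
  proof (rule lborel_pair.Fubini_integrable)
    have "integrable lborel (\<lambda>z. G z * L)" using G by simp
    moreover have "(\<integral>y. norm (G z *\<^sub>R g (y + c *\<^sub>R z)) \<partial>lborel) = G z * L" for z
      using L'[of "c *\<^sub>R z"] G0[of z] by simp
    ultimately show "integrable lborel (\<lambda>z. \<integral>y. norm (case (z, y) of (z, y) \<Rightarrow> G z *\<^sub>R g (y + c *\<^sub>R z)) \<partial>lborel)" 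
      by simp
    show "AE z in lborel. integrable lborel (\<lambda>y. case (z, y) of (z, y) \<Rightarrow> G z *\<^sub>R g (y + c *\<^sub>R z))"
      using gh by simp
  qed measurable
  have AEi: "AE y in lborel. integrable lborel (\<lambda>z. G z *\<^sub>R g (y + c *\<^sub>R z))" for c
    using lborel_pair.AE_integrable_snd[OF prod1[of c]] by auto
  show conv_int: "integrable lborel (\<lambda>y. \<integral>z. G z *\<^sub>R g (y + c *\<^sub>R z) \<partial>lborel)" for c
    using lborel_pair.integrable_snd[OF prod1[of c]] by auto
  have prod2: "integrable (lborel \<Otimes>\<^sub>M lborel) (\<lambda>(z,y). G z * norm (g (y + c *\<^sub>R z) - g y))" for c
  proof (rule lborel_pair.Fubini_integrable)
    have *: "(\<integral>y. norm (G z * norm (g (y + c *\<^sub>R z) - g y)) \<partial>lborel) = G z * \<tau> (c *\<^sub>R z)" for z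
      using G0[of z] by (simp add: \<tau>_def)
    have "integrable lborel (\<lambda>z. G z * \<tau> (c *\<^sub>R z))"
    proof (rule Bochner_Integration.integrable_bound[where f="\<lambda>z. G z * (2 * L)"])
      show "AE z in lborel. norm (G z * \<tau> (c *\<^sub>R z)) \<le> norm (G z * (2 * L))"
        using \<tau>le \<tau>0 G0 L0 by (intro AE_I2) (auto simp: abs_mult intro!: mult_left_mono)
    qed (use G in auto)
    then show "integrable lborel (\<lambda>z. \<integral>y. norm (case (z, y) of (z, y) \<Rightarrow> G z * norm (g (y + c *\<^sub>R z) - g y)) \<partial>lborel)"
      by (simp only: prod.case *)
    show "AE z in lborel. integrable lborel (\<lambda>y. case (z, y) of (z, y) \<Rightarrow> G z * norm (g (y + c *\<^sub>R z) - g y))"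
      using ih by simp
  qed measurable
  have bound: "(\<integral>y. norm ((\<integral>z. G z *\<^sub>R g (y + c *\<^sub>R z) \<partial>lborel) - g y) \<partial>lborel) \<le> (\<integral>z. G z * \<tau> (c *\<^sub>R z) \<partial>lborel)" for c
  proof -
    have "(\<integral>y. norm ((\<integral>z. G z *\<^sub>R g (y + c *\<^sub>R z) \<partial>lborel) - g y) \<partial>lborel)
        \<le> (\<integral>y. (\<integral>z. G z * norm (g (y + c *\<^sub>R z) - g y) \<partial>lborel) \<partial>lborel)"
    proof (rule integral_mono_AE)
      show "integrable lborel (\<lambda>y. norm ((\<integral>z. G z *\<^sub>R g (y + c *\<^sub>R z) \<partial>lborel) - g y))"
        by (intro integrable_norm Bochner_Integration.integrable_diff conv_int g)
      show "integrable lborel (\<lambda>y. \<integral>z. G z * norm (g (y + c *\<^sub>R z) - g y) \<partial>lborel)"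
        using lborel_pair.integrable_snd[OF prod2[of c]] by auto
      show "AE y in lborel. norm ((\<integral>z. G z *\<^sub>R g (y + c *\<^sub>R z) \<partial>lborel) - g y) \<le> (\<integral>z. G z * norm (g (y + c *\<^sub>R z) - g y) \<partial>lborel)"
        using AEi[of c]
      proof eventually_elim
        case (elim y)
        have "(\<integral>z. G z *\<^sub>R g (y + c *\<^sub>R z) \<partial>lborel) - g y = (\<integral>z. G z *\<^sub>R g (y + c *\<^sub>R z) \<partial>lborel) - (\<integral>z. G z *\<^sub>R g y \<partial>lborel)"
          using G G1 by simp
        also have "\<dots> = (\<integral>z. G z *\<^sub>R (g (y + c *\<^sub>R z) - g y) \<partial>lborel)"
          using elim G by (subst Bochner_Integration.integral_diff[symmetric]) (auto simp: scaleR_diff_right)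
        also have "norm \<dots> \<le> (\<integral>z. norm (G z *\<^sub>R (g (y + c *\<^sub>R z) - g y)) \<partial>lborel)"
          by (rule integral_norm_bound)
        finally show ?case using G0 by simp
      qed
    qed
    also have "\<dots> = (\<integral>z. (\<integral>y. G z * norm (g (y + c *\<^sub>R z) - g y) \<partial>lborel) \<partial>lborel)"
      by (rule lborel_pair.Fubini_integral[OF prod2])
    finally show ?thesis by (simp add: \<tau>_def)
  qed
  have lim: "(\<lambda>n. \<integral>z. G z * \<tau> (e n *\<^sub>R z) \<partial>lborel) \<longlonglongrightarrow> (\<integral>z. (0::real) \<partial>(lborel::'a measure))"
  proof (rule integral_dominated_convergence)
    show "integrable lborel (\<lambda>z. G z * (2 * L))" using G by simp
    show "AE z in lborel. norm (G z * \<tau> (e n *\<^sub>R z)) \<le> G z * (2 * L)" for n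
      using \<tau>le \<tau>0 G0 by (intro AE_I2) (auto simp: abs_mult intro!: mult_left_mono)
    show "AE z in lborel. (\<lambda>n. G z * \<tau> (e n *\<^sub>R z)) \<longlonglongrightarrow> 0"
    proof (rule AE_I2)
      fix z :: 'a
      have "(\<lambda>n. e n *\<^sub>R z) \<longlonglongrightarrow> 0" using tendsto_scaleR[OF e tendsto_const, of z] by simp
      then have "(\<lambda>n. \<tau> (e n *\<^sub>R z)) \<longlonglongrightarrow> 0"
        unfolding \<tau>_def by (rule tendsto_L1_translate[OF g])
      then show "(\<lambda>n. G z * \<tau> (e n *\<^sub>R z)) \<longlonglongrightarrow> 0" by (rule tendsto_mult_right_zero)
    qed
  qed auto
  show "(\<lambda>n. \<integral>y. norm ((\<integral>z. G z *\<^sub>R g (y + e n *\<^sub>R z) \<partial>lborel) - g y) \<partial>lborel) \<longlonglongrightarrow> 0"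
    by (rule tendsto_sandwich[OF _ _ tendsto_const lim[simplified]]) (use bound in auto)
qed

section \<open>Gaussians\<close>

definition gauss :: "'a::euclidean_space \<Rightarrow> real" where
  "gauss x = (1 / sqrt (2 * pi)) ^ DIM('a) * exp (- (norm x)\<^sup>2 / 2)"

lemma gauss_nonneg: "gauss x \<ge> 0"
  by (simp add: gauss_def)

lemma gauss_borel[measurable]: "gauss \<in> borel_measurable borel"
  unfolding gauss_def[abs_def] by measurable

lemma norm_sq_Basis: "(norm (x::'a::euclidean_space))\<^sup>2 = (\<Sum>b\<in>Basis. (x \<bullet> b)\<^sup>2)"
  unfolding power2_norm_eq_inner by (subst euclidean_inner) (simp add: power2_eq_square)

lemma exp_norm_sq: "exp (- (norm (x::'a::euclidean_space))\<^sup>2 / 2) = (\<Prod>b\<in>Basis. exp (- (x \<bullet> b)\<^sup>2 / 2))"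
proof -
  have "- (norm x)\<^sup>2 / 2 = (\<Sum>b\<in>Basis. - (x \<bullet> b)\<^sup>2 / 2)"
    by (simp add: norm_sq_Basis sum_divide_distrib sum_negf)
  then show ?thesis by (simp only: exp_sum[OF finite_Basis])
qed

lemma gauss_prod: "gauss (x::'a::euclidean_space) = (\<Prod>b\<in>Basis. std_normal_density (x \<bullet> b))"
  unfolding gauss_def exp_norm_sq by (simp add: std_normal_density_def prod_dividef power_one_over)

lemma cis_sum: "cis (\<Sum>i\<in>A. f i) = (\<Prod>i\<in>A. cis (f i))"
  by (induction A rule: infinite_finite_induct) (auto simp flip: cis_mult)

lemma integrable_gauss: "integrable lborel (gauss :: 'a::euclidean_space \<Rightarrow> real)"
proof -
  have "integrable lborel std_normal_density"
    using integrable_std_normal_moment[of 0] by simp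
  then have "integrable lborel (\<lambda>x::'a. \<Prod>b\<in>Basis. std_normal_density (x \<bullet> b))"
    by (intro integrable_lborel_prod_Basis)
  then show ?thesis by (simp add: gauss_prod[abs_def])
qed

text \<open>Both the density and the character factor over the coordinates, and each factor is the
  characteristic function of the standard normal distribution.\<close>

lemma integral_gauss_cis:
  "(\<integral>x. of_real (gauss x) * cis (x \<bullet> t) \<partial>lborel) = complex_of_real (exp (- (norm t)\<^sup>2 / 2))"
  for t :: "'a::euclidean_space"
proof -
  have 1: "(\<integral>x. complex_of_real (std_normal_density x) * cis (x * s) \<partial>lborel) = of_real (exp (- s\<^sup>2 / 2))" for s
  proof -
    have "of_real (exp (- s\<^sup>2 / 2)) = char std_normal_distribution s"
      by (simp add: char_std_normal_distribution)
    also have "\<dots> = (\<integral>x. std_normal_density x *\<^sub>R iexp (s * x) \<partial>lborel)"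
      unfolding char_def by (subst integral_density) auto
    finally show ?thesis by (simp add: cis_conv_exp scaleR_conv_of_real mult_ac)
  qed
  have i: "integrable lborel (\<lambda>x. complex_of_real (std_normal_density x) * cis (x * s))" for s
  proof (rule Bochner_Integration.integrable_bound[where f=std_normal_density])
    show "integrable lborel std_normal_density"
      using integrable_std_normal_moment[of 0] by simp
  qed (auto simp: norm_mult cis_conv_exp)
  have inner: "x \<bullet> t = (\<Sum>b\<in>Basis. (x \<bullet> b) * (t \<bullet> b))" for x
    by (rule euclidean_inner)
  have "(\<integral>x. of_real (gauss x) * cis (x \<bullet> t) \<partial>lborel) =
      (\<integral>x. (\<Prod>b\<in>Basis. complex_of_real (std_normal_density (x \<bullet> b)) * cis ((x \<bullet> b) * (t \<bullet> b))) \<partial>lborel)"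
    by (simp add: gauss_prod prod.distrib cis_sum inner)
  also have "\<dots> = (\<Prod>b\<in>Basis. of_real (exp (- (t \<bullet> b)\<^sup>2 / 2)))"
    by (subst integrable_lborel_prod_Basis(2)[OF i]) (simp add: 1)
  also have "\<dots> = of_real (exp (- (norm t)\<^sup>2 / 2))"
    by (simp only: exp_norm_sq of_real_prod)
  finally show ?thesis .
qed

lemma integral_gauss: "(\<integral>x. gauss x \<partial>(lborel::'a::euclidean_space measure)) = 1"
proof -
  have "complex_of_real (\<integral>x. gauss x \<partial>(lborel::'a measure)) = 1"
    using integral_gauss_cis[of "0::'a"] by simp
  then show ?thesis by (simp only: of_real_eq_1_iff)
qed

text \<open>Substitution of \<open>x / e\<close> for \<open>x\<close>. One factor
  \<open>sqrt (2 * pi) ^ DIM('a)\<close> comes from undoing the normalisation on the left, a second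
  one from expressing the result through \<open>gauss\<close> again. The right side is written at
  \<open>s /\<^sub>R e\<close> so that a later substitution turns it into an average of
  translates.\<close>

lemma gaussian_scaled:
  fixes s :: "'a::euclidean_space"
  assumes e: "e > 0"
  shows "integrable lborel (\<lambda>x::'a. exp (- (e * norm x)\<^sup>2 / 2))"
    and "(\<integral>x. of_real (exp (- (e * norm x)\<^sup>2 / 2)) * cis (x \<bullet> s) \<partial>lborel) =
      complex_of_real ((2 * pi) ^ DIM('a) * (1 / e) ^ DIM('a) * gauss (s /\<^sub>R e))"
proof -
  have ex: "exp (- (e * norm x)\<^sup>2 / 2) = sqrt (2 * pi) ^ DIM('a) * gauss (0 + e *\<^sub>R x)" for x :: 'a
    using e by (simp add: gauss_def power_one_over)
  show "integrable lborel (\<lambda>x::'a. exp (- (e * norm x)\<^sup>2 / 2))"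
    unfolding ex using e by (intro integrable_mult_right integrable_lborel_affine integrable_gauss) auto
  have "(\<integral>x. of_real (exp (- (e * norm x)\<^sup>2 / 2)) * cis (x \<bullet> s) \<partial>lborel) =
     \<bar>1 / e\<bar> ^ DIM('a) *\<^sub>R (\<integral>x. of_real (exp (- (e * norm (0 + (1 / e) *\<^sub>R x))\<^sup>2 / 2)) * cis ((0 + (1 / e) *\<^sub>R x) \<bullet> s) \<partial>lborel)"
    using e by (intro integral_lborel_affine) (auto simp: cis_conv_exp)
  also have "(\<integral>x. of_real (exp (- (e * norm (0 + (1 / e) *\<^sub>R x))\<^sup>2 / 2)) * cis ((0 + (1 / e) *\<^sub>R x) \<bullet> s) \<partial>lborel)
     = (\<integral>x. of_real (sqrt (2 * pi) ^ DIM('a)) * (complex_of_real (gauss x) * cis (x \<bullet> (s /\<^sub>R e))) \<partial>lborel)"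
  proof (intro Bochner_Integration.integral_cong refl)
    fix x :: 'a
    have "e * norm (0 + (1 / e) *\<^sub>R x) = norm x" "(0 + (1 / e) *\<^sub>R x) \<bullet> s = x \<bullet> (s /\<^sub>R e)"
      using e by (simp_all add: inverse_eq_divide)
    moreover have "exp (- (norm x)\<^sup>2 / 2) = sqrt (2 * pi) ^ DIM('a) * gauss x"
      by (simp add: gauss_def power_one_over)
    ultimately show "of_real (exp (- (e * norm (0 + (1 / e) *\<^sub>R x))\<^sup>2 / 2)) * cis ((0 + (1 / e) *\<^sub>R x) \<bullet> s)
      = of_real (sqrt (2 * pi) ^ DIM('a)) * (complex_of_real (gauss x) * cis (x \<bullet> (s /\<^sub>R e)))"
      by (simp only: of_real_mult mult.assoc)
  qed
  also have "\<dots> = of_real (sqrt (2 * pi) ^ DIM('a)) * of_real (exp (- (norm (s /\<^sub>R e))\<^sup>2 / 2))"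
    by (simp only: integral_mult_right_zero integral_gauss_cis)
  also have "\<dots> = of_real ((2 * pi) ^ DIM('a) * gauss (s /\<^sub>R e))"
  proof -
    define q where "q = sqrt (2 * pi)"
    have q: "2 * pi = q * q" "q > 0" by (simp_all add: q_def)
    have "(2 * pi) ^ DIM('a) * gauss (s /\<^sub>R e) = q ^ DIM('a) * exp (- (norm (s /\<^sub>R e))\<^sup>2 / 2)"
      unfolding gauss_def q_def[symmetric] q(1) power_mult_distrib using q(2) by (simp add: power_one_over)
    then show ?thesis by (simp only: q_def of_real_mult)
  qed
  finally show "(\<integral>x. of_real (exp (- (e * norm x)\<^sup>2 / 2)) * cis (x \<bullet> s) \<partial>lborel) =
      complex_of_real ((2 * pi) ^ DIM('a) * (1 / e) ^ DIM('a) * gauss (s /\<^sub>R e))"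
    using e by (simp add: scaleR_conv_of_real)
qed

lemma cis_borel[measurable]: "cis \<in> borel_measurable borel"
  by (simp add: cis_conv_exp[abs_def])

text \<open>Fubini is justified by the Gaussian in \<open>x\<close> and by \<open>g\<close> in
  \<open>y\<close>, whether or not the transform of \<open>g\<close> is integrable. The inner
  integral is a Gaussian centred at \<open>t\<close>, and \<open>y = t + e *\<^sub>R z\<close>
  absorbs the power of \<open>1 / e\<close>.\<close>

lemma fourier_gaussian_times_inverse:
  fixes g :: "'a::euclidean_space \<Rightarrow> complex"
  assumes g: "integrable lborel g" and e: "e > 0"
  shows "(\<integral>x. (of_real (exp (- (e * norm x)\<^sup>2 / 2)) * (\<integral>y. g y * cis (x \<bullet> y) \<partial>lborel)) * cis (- (x \<bullet> t)) \<partial>lborel)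
    = of_real ((2 * pi) ^ DIM('a)) * (\<integral>z. gauss z *\<^sub>R g (t + e *\<^sub>R z) \<partial>lborel)"
proof -
  have [measurable]: "g \<in> borel_measurable borel" using g by auto
  define F where "F = (\<lambda>x y. of_real (exp (- (e * norm x)\<^sup>2 / 2)) * g y * cis (x \<bullet> (y - t)))"
  have nF: "norm (F x y) = exp (- (e * norm x)\<^sup>2 / 2) * norm (g y)" for x y
    by (simp add: F_def norm_mult)
  have iF: "integrable (lborel \<Otimes>\<^sub>M lborel) (case_prod F)"
  proof (rule lborel_pair.Fubini_integrable)
    show "case_prod F \<in> borel_measurable (lborel \<Otimes>\<^sub>M lborel)" unfolding F_def by measurable
    show "integrable lborel (\<lambda>x. \<integral>y. norm (case (x, y) of (x, y) \<Rightarrow> F x y) \<partial>lborel)"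
      using gaussian_scaled(1)[OF e, where ?'a='a] by (simp add: nF)
    have "integrable lborel (F x)" for x
    proof (rule Bochner_Integration.integrable_bound)
      show "integrable lborel (\<lambda>y. exp (- (e * norm x)\<^sup>2 / 2) * norm (g y))" using g by simp
      show "F x \<in> borel_measurable lborel" unfolding F_def by measurable
    qed (simp add: nF)
    then show "AE x in lborel. integrable lborel (\<lambda>y. case (x, y) of (x, y) \<Rightarrow> F x y)" by simp
  qed
  have "(\<integral>x. (of_real (exp (- (e * norm x)\<^sup>2 / 2)) * (\<integral>y. g y * cis (x \<bullet> y) \<partial>lborel)) * cis (- (x \<bullet> t)) \<partial>lborel)
     = (\<integral>x. (\<integral>y. F x y \<partial>lborel) \<partial>lborel)"
  proof (intro Bochner_Integration.integral_cong refl)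
    fix x :: 'a
    have "F x = (\<lambda>y. (of_real (exp (- (e * norm x)\<^sup>2 / 2)) * cis (- (x \<bullet> t))) * (g y * cis (x \<bullet> y)))"
      by (auto simp: F_def inner_diff_right fun_eq_iff cis_mult mult_ac)
    then show "(of_real (exp (- (e * norm x)\<^sup>2 / 2)) * (\<integral>y. g y * cis (x \<bullet> y) \<partial>lborel)) * cis (- (x \<bullet> t)) = (\<integral>y. F x y \<partial>lborel)"
      by (simp only: integral_mult_right_zero) (simp add: mult_ac)
  qed
  also have "\<dots> = (\<integral>y. (\<integral>x. F x y \<partial>lborel) \<partial>lborel)"
    using lborel_pair.Fubini_integral[OF iF] by simp
  also have "\<dots> = (\<integral>y. g y * of_real ((2 * pi) ^ DIM('a) * (1 / e) ^ DIM('a) * gauss ((y - t) /\<^sub>R e)) \<partial>lborel)"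
  proof (intro Bochner_Integration.integral_cong refl)
    fix y
    have "(\<lambda>x. F x y) = (\<lambda>x. g y * (of_real (exp (- (e * norm x)\<^sup>2 / 2)) * cis (x \<bullet> (y - t))))"
      by (auto simp: F_def mult_ac)
    then show "(\<integral>x. F x y \<partial>lborel) = g y * of_real ((2 * pi) ^ DIM('a) * (1 / e) ^ DIM('a) * gauss ((y - t) /\<^sub>R e))"
      by (simp only: integral_mult_right_zero gaussian_scaled(2)[OF e])
  qed
  also have "\<dots> = \<bar>e\<bar> ^ DIM('a) *\<^sub>R (\<integral>z. g (t + e *\<^sub>R z) * of_real ((2 * pi) ^ DIM('a) * (1 / e) ^ DIM('a) * gauss ((t + e *\<^sub>R z - t) /\<^sub>R e)) \<partial>lborel)"
    using e by (intro integral_lborel_affine) auto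
  also have "(\<integral>z. g (t + e *\<^sub>R z) * of_real ((2 * pi) ^ DIM('a) * (1 / e) ^ DIM('a) * gauss ((t + e *\<^sub>R z - t) /\<^sub>R e)) \<partial>lborel)
     = (\<integral>z. of_real ((2 * pi) ^ DIM('a) * (1 / e) ^ DIM('a)) * (gauss z *\<^sub>R g (t + e *\<^sub>R z)) \<partial>lborel)"
    using e by (intro Bochner_Integration.integral_cong refl) (simp add: scaleR_conv_of_real mult_ac)
  also have "\<dots> = of_real ((2 * pi) ^ DIM('a) * (1 / e) ^ DIM('a)) * (\<integral>z. gauss z *\<^sub>R g (t + e *\<^sub>R z) \<partial>lborel)"
    by (simp only: integral_mult_right_zero)
  finally show ?thesis
    using e by (simp add: scaleR_conv_of_real power_one_over)
qed

section \<open>Schwartz functions\<close>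

definition rapidly_decreasing :: "('a::real_normed_vector \<Rightarrow> complex) \<Rightarrow> bool" where
  "rapidly_decreasing f \<longleftrightarrow> (\<forall>m::nat. bounded (range (\<lambda>x. (1 + norm x) ^ m * cmod (f x))))"

lemma rapidly_decreasingI:
  assumes "\<And>m. \<exists>C. \<forall>x. (1 + norm x) ^ m * cmod (f x) \<le> C"
  shows "rapidly_decreasing f"
  unfolding rapidly_decreasing_def
proof
  fix m
  obtain C where "\<And>x. (1 + norm x) ^ m * cmod (f x) \<le> C" using assms by blast
  then show "bounded (range (\<lambda>x. (1 + norm x) ^ m * cmod (f x)))"
    by (intro boundedI[of _ C]) auto
qed

lemma rapidly_decreasingD:
  assumes "rapidly_decreasing f"
  obtains C where "C > 0" "\<And>x. (1 + norm x) ^ m * cmod (f x) \<le> C"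
proof -
  have "bounded (range (\<lambda>x. (1 + norm x) ^ m * cmod (f x)))"
    using assms by (simp add: rapidly_decreasing_def)
  then obtain C where "C > 0" "\<forall>y\<in>range (\<lambda>x. (1 + norm x) ^ m * cmod (f x)). norm y \<le> C"
    by (auto simp: bounded_pos)
  then show thesis by (intro that[of C]) (auto simp: abs_le_iff)
qed

text \<open>If every member of \<open>B\<close> is rapidly decreasing and its partial derivatives lie in
  \<open>polyspan B\<close>, then \<open>polyspan B\<close> is closed under differentiation and so consists of Schwartz functions
  (lemma \<open>polyspan_schwartz\<close>).\<close>
inductive polyspan :: "('a::euclidean_space \<Rightarrow> complex) set \<Rightarrow> ('a \<Rightarrow> complex) \<Rightarrow> bool"
  for B where
  base: "f \<in> B \<Longrightarrow> polyspan B f"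
| add: "polyspan B f \<Longrightarrow> polyspan B g \<Longrightarrow> polyspan B (\<lambda>x. f x + g x)"
| scale: "polyspan B f \<Longrightarrow> polyspan B (\<lambda>x. c * f x)"
| coord: "b \<in> Basis \<Longrightarrow> polyspan B f \<Longrightarrow> polyspan B (\<lambda>x. of_real (x \<bullet> b) * f x)"

text \<open>The property demanded of the generators is exactly the one concluded, so induction
  carries decay and derivatives together: the sum and product rules produce only further elements of
  the span.\<close>

lemma polyspan_smooth:
  assumes B: "\<And>f. f \<in> B \<Longrightarrow> rapidly_decreasing f \<and>
     (\<exists>D. (\<forall>x. (f has_derivative D x) (at x)) \<and> (\<forall>b\<in>Basis. polyspan B (\<lambda>x. D x b)))"
    and f: "polyspan B f"
  shows "rapidly_decreasing f \<and>
     (\<exists>D. (\<forall>x. (f has_derivative D x) (at x)) \<and> (\<forall>b\<in>Basis. polyspan B (\<lambda>x. D x b)))"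
  using f
proof induction
  case (base f)
  then show ?case by (rule B)
next
  case (add f g)
  then obtain D E where D: "\<forall>x. (f has_derivative D x) (at x)" "\<forall>b\<in>Basis. polyspan B (\<lambda>x. D x b)"
    and E: "\<forall>x. (g has_derivative E x) (at x)" "\<forall>b\<in>Basis. polyspan B (\<lambda>x. E x b)"
    by blast
  have "rapidly_decreasing (\<lambda>x. f x + g x)"
  proof (rule rapidly_decreasingI)
    fix m
    obtain C1 where C1: "\<And>x. (1 + norm x) ^ m * cmod (f x) \<le> C1"
      using rapidly_decreasingD add.IH by metis
    obtain C2 where C2: "\<And>x. (1 + norm x) ^ m * cmod (g x) \<le> C2"
      using rapidly_decreasingD add.IH by metis
    have "(1 + norm x) ^ m * cmod (f x + g x) \<le> C1 + C2" for x
    proof -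
      have "(1 + norm x) ^ m * cmod (f x + g x) \<le> (1 + norm x) ^ m * (cmod (f x) + cmod (g x))"
        by (intro mult_left_mono norm_triangle_ineq) auto
      then show ?thesis using C1[of x] C2[of x] by (simp add: distrib_left)
    qed
    then show "\<exists>C. \<forall>x. (1 + norm x) ^ m * cmod (f x + g x) \<le> C" by blast
  qed
  moreover have "\<forall>x. ((\<lambda>x. f x + g x) has_derivative (\<lambda>v. D x v + E x v)) (at x)"
    using D E by (auto intro: has_derivative_add)
  moreover have "\<forall>b\<in>Basis. polyspan B (\<lambda>x. D x b + E x b)"
    using D E by (auto intro: polyspan.add)
  ultimately show ?case by (intro conjI exI[of _ "\<lambda>x v. D x v + E x v"]) auto
next
  case (scale f c)
  then obtain D where D: "\<forall>x. (f has_derivative D x) (at x)" "\<forall>b\<in>Basis. polyspan B (\<lambda>x. D x b)"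
    by blast
  have "rapidly_decreasing (\<lambda>x. c * f x)"
  proof (rule rapidly_decreasingI)
    fix m
    obtain C1 where C1: "\<And>x. (1 + norm x) ^ m * cmod (f x) \<le> C1"
      using rapidly_decreasingD scale.IH by metis
    have "(1 + norm x) ^ m * cmod (c * f x) \<le> cmod c * C1" for x
      using mult_left_mono[OF C1[of x], of "cmod c"] by (simp add: norm_mult mult_ac)
    then show "\<exists>C. \<forall>x. (1 + norm x) ^ m * cmod (c * f x) \<le> C" by blast
  qed
  moreover have "\<forall>x. ((\<lambda>x. c * f x) has_derivative (\<lambda>v. c * D x v)) (at x)"
    using D by (auto intro: has_derivative_mult_right)
  moreover have "\<forall>b\<in>Basis. polyspan B (\<lambda>x. c * D x b)"
    using D by (auto intro: polyspan.scale)
  ultimately show ?case by (intro conjI exI[of _ "\<lambda>x v. c * D x v"]) auto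
next
  case (coord b f)
  then obtain D where D: "\<forall>x. (f has_derivative D x) (at x)" "\<forall>b\<in>Basis. polyspan B (\<lambda>x. D x b)"
    by blast
  have "rapidly_decreasing (\<lambda>x. of_real (x \<bullet> b) * f x)"
  proof (rule rapidly_decreasingI)
    fix m
    \<comment> \<open>One additional power pays for the coordinate factor, which is at most
      \<open>1 + norm x\<close>.\<close>
    obtain C1 where C1: "\<And>x. (1 + norm x) ^ Suc m * cmod (f x) \<le> C1"
      using rapidly_decreasingD coord.IH by metis
    have "(1 + norm x) ^ m * cmod (of_real (x \<bullet> b) * f x) \<le> C1" for x
    proof -
      have "\<bar>x \<bullet> b\<bar> \<le> 1 + norm x" using Basis_le_norm[OF coord.hyps(1), of x] by simp
      then have "(1 + norm x) ^ m * (\<bar>x \<bullet> b\<bar> * cmod (f x)) \<le> (1 + norm x) ^ m * ((1 + norm x) * cmod (f x))"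
        by (intro mult_left_mono mult_right_mono) auto
      then show ?thesis using C1[of x] by (simp add: norm_mult mult_ac)
    qed
    then show "\<exists>C. \<forall>x. (1 + norm x) ^ m * cmod (of_real (x \<bullet> b) * f x) \<le> C" by blast
  qed
  moreover have "\<forall>x. ((\<lambda>x. of_real (x \<bullet> b) * f x) has_derivative (\<lambda>v. of_real (x \<bullet> b) * D x v + of_real (v \<bullet> b) * f x)) (at x)"
    using D by (auto intro!: derivative_eq_intros)
  moreover have "\<forall>a\<in>Basis. polyspan B (\<lambda>x. of_real (x \<bullet> b) * D x a + of_real (a \<bullet> b) * f x)"
    using D coord by (auto intro!: polyspan.intros(2) polyspan.coord polyspan.scale)
  ultimately show ?case by (intro conjI exI[of _ "\<lambda>x v. of_real (x \<bullet> b) * D x v + of_real (v \<bullet> b) * f x"]) auto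
qed

lemma vector_derivative_along:
  assumes "(f has_derivative D) (at x)"
  shows "vector_derivative (\<lambda>t. f (x + t *\<^sub>R v)) (at 0) = D v"
proof (rule vector_derivative_at)
  have "((\<lambda>t. x + t *\<^sub>R v) has_derivative (\<lambda>t. t *\<^sub>R v)) (at 0)"
    by (auto intro!: derivative_eq_intros)
  moreover have "(f has_derivative D) (at (x + 0 *\<^sub>R v))" using assms by simp
  ultimately have "((\<lambda>t. f (x + t *\<^sub>R v)) has_derivative (\<lambda>t. D (t *\<^sub>R v))) (at 0)"
    by (rule has_derivative_compose)
  then show "((\<lambda>t. f (x + t *\<^sub>R v)) has_vector_derivative D v) (at 0)"
    unfolding has_vector_derivative_def
    by (simp add: linear_scale[OF has_derivative_linear[OF assms]])
qed

lemma polyspan_schwartz: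
  fixes B :: "(real ^ 'n \<Rightarrow> complex) set"
  assumes B: "\<And>f. f \<in> B \<Longrightarrow> rapidly_decreasing f \<and>
     (\<exists>D. (\<forall>x. (f has_derivative D x) (at x)) \<and> (\<forall>b\<in>Basis. polyspan B (\<lambda>x. D x b)))"
    and f: "polyspan B f"
  shows "schwartz f"
proof -
  have *: "polyspan B (pderivs vs f)" if "set vs \<subseteq> Basis" for vs
    using that
  proof (induction vs)
    case Nil
    then show ?case using f by simp
  next
    case (Cons v vs)
    then obtain D where D: "\<forall>x. (pderivs vs f has_derivative D x) (at x)" "\<forall>b\<in>Basis. polyspan B (\<lambda>x. D x b)"
      using polyspan_smooth[OF B, of "pderivs vs f"] by auto
    have "pderivs (v # vs) f = (\<lambda>x. D x v)"
      using D(1) vector_derivative_along by fastforce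
    then show ?case using D(2) Cons.prems by auto
  qed
  show ?thesis
    unfolding schwartz_def
    using polyspan_smooth[OF B *] unfolding rapidly_decreasing_def differentiable_def by blast
qed

section \<open>Regularity and integrability of Schwartz functions\<close>

lemma pderivs_append: "pderivs (vs @ ws) f = pderivs vs (pderivs ws f)"
  by (induction vs) auto

lemma schwartz_pderivs:
  assumes "schwartz u" "set ws \<subseteq> Basis"
  shows "schwartz (pderivs ws u)"
  using assms unfolding schwartz_def pderivs_append[symmetric] by simp

lemma schwartz_rapidly_decreasing: "schwartz u \<Longrightarrow> rapidly_decreasing u"
  unfolding schwartz_def rapidly_decreasing_def by (metis empty_subsetI list.set(1) pderivs.simps(1))

lemma schwartz_differentiable: "schwartz u \<Longrightarrow> u differentiable (at x)"
  unfolding schwartz_def by (metis empty_subsetI list.set(1) pderivs.simps(1))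

lemma schwartz_has_derivative:
  assumes "schwartz u"
  shows "(u has_derivative frechet_derivative u (at x)) (at x)"
    and "pderivs [b] u x = frechet_derivative u (at x) b"
proof -
  show 1: "(u has_derivative frechet_derivative u (at x)) (at x)"
    using schwartz_differentiable[OF assms] by (simp add: frechet_derivative_works)
  show "pderivs [b] u x = frechet_derivative u (at x) b"
    using vector_derivative_along[OF 1] by simp
qed

lemma schwartz_continuous: "schwartz u \<Longrightarrow> continuous_on UNIV u"
  using schwartz_differentiable differentiable_imp_continuous_within continuous_on_eq_continuous_within
  by blast

lemma schwartz_borel: "schwartz u \<Longrightarrow> u \<in> borel_measurable borel"
  by (intro borel_measurable_continuous_onI schwartz_continuous)

text \<open>The majorant is the product of the one-dimensional functions
  \<open>inverse (1 + t\<^sup>2)\<close> over the coordinates. Each factor dominates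
  \<open>inverse ((1 + norm x)\<^sup>2)\<close>, which is the origin of the exponent
  \<open>2 * DIM('a)\<close>.\<close>

lemma integrable_inverse_power_norm:
  "integrable lborel (\<lambda>x::'a::euclidean_space. 1 / (1 + norm x) ^ (2 * DIM('a)))"
proof -
  have "integrable lborel (\<lambda>x::real. inverse (1 + x\<^sup>2))"
    using integrable_inverse_1_plus_square by (simp add: set_integrable_def)
  then have i: "integrable lborel (\<lambda>x::'a. \<Prod>b\<in>Basis. inverse (1 + (x \<bullet> b)\<^sup>2))"
    by (intro integrable_lborel_prod_Basis)
  show ?thesis
  proof (rule Bochner_Integration.integrable_bound[OF i])
    show "AE x::'a in lborel. norm (1 / (1 + norm x) ^ (2 * DIM('a))) \<le> norm (\<Prod>b\<in>Basis. inverse (1 + (x \<bullet> b)\<^sup>2))"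
    proof (rule AE_I2)
      fix x :: 'a
      have "(\<Prod>b\<in>(Basis::'a set). inverse ((1 + norm x)\<^sup>2)) \<le> (\<Prod>b\<in>Basis. inverse (1 + (x \<bullet> b)\<^sup>2))"
      proof (intro prod_mono conjI le_imp_inverse_le)
        fix b :: 'a assume b: "b \<in> Basis"
        have "(x \<bullet> b)\<^sup>2 \<le> (norm x)\<^sup>2"
          using Basis_le_norm[OF b, of x] by (simp flip: abs_le_square_iff)
        then show "1 + (x \<bullet> b)\<^sup>2 \<le> (1 + norm x)\<^sup>2"
          using norm_ge_zero[of x] by (simp add: power2_sum del: norm_ge_zero)
        show "0 < 1 + (x \<bullet> b)\<^sup>2" by (simp add: add_pos_nonneg)
      qed auto
      moreover have "(\<Prod>b\<in>(Basis::'a set). inverse ((1 + norm x)\<^sup>2)) = 1 / (1 + norm x) ^ (2 * DIM('a))"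
        by (simp add: power_mult divide_inverse power_inverse)
      ultimately have "1 / (1 + norm x) ^ (2 * DIM('a)) \<le> (\<Prod>b\<in>Basis. inverse (1 + (x \<bullet> b)\<^sup>2))"
        by linarith
      moreover have "0 \<le> 1 / (1 + norm x) ^ (2 * DIM('a))" by simp
      ultimately show "norm (1 / (1 + norm x) ^ (2 * DIM('a))) \<le> norm (\<Prod>b\<in>Basis. inverse (1 + (x \<bullet> b)\<^sup>2))"
        unfolding real_norm_def by linarith
    qed
  qed auto
qed

lemma rapidly_decreasing_integrable:
  fixes f :: "'a::euclidean_space \<Rightarrow> complex"
  assumes r: "rapidly_decreasing f" and m: "f \<in> borel_measurable borel"
  shows "integrable lborel (\<lambda>x. (1 + norm x) ^ k * cmod (f x))" "integrable lborel f"
proof -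
  have *: "integrable lborel (\<lambda>x. (1 + norm x) ^ k * cmod (f x))" for k
  proof -
    obtain C where C: "C > 0" "\<And>x. (1 + norm x) ^ (k + 2 * DIM('a)) * cmod (f x) \<le> C"
      using rapidly_decreasingD[OF r] by metis
    have i: "integrable lborel (\<lambda>x::'a. C * (1 / (1 + norm x) ^ (2 * DIM('a))))"
      by (intro integrable_mult_right integrable_inverse_power_norm)
    show ?thesis
    proof (rule Bochner_Integration.integrable_bound[OF i])
      show "AE x in lborel. norm ((1 + norm x) ^ k * cmod (f x)) \<le> norm (C * (1 / (1 + norm x) ^ (2 * DIM('a))))"
      proof (rule AE_I2)
        fix x :: 'a
        have p: "(1 + norm x) ^ (2 * DIM('a)) > 0" by (simp add: add_pos_nonneg)
        have "(1 + norm x) ^ k * cmod (f x) \<le> C / (1 + norm x) ^ (2 * DIM('a))"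
          using C(2)[of x] p by (simp add: pos_le_divide_eq power_add mult_ac)
        then show "norm ((1 + norm x) ^ k * cmod (f x)) \<le> norm (C * (1 / (1 + norm x) ^ (2 * DIM('a))))"
          using C(1) by simp
      qed
    qed (use m in measurable)
  qed
  show "integrable lborel (\<lambda>x. (1 + norm x) ^ k * cmod (f x))" by (rule *)
  show "integrable lborel f"
    using *[of 0] m by (simp add: integrable_norm_iff)
qed

section \<open>Decay of the Fourier transform\<close>

text \<open>Unnormalised inverse Fourier transform, with respect to Borel instead of Lebesgue measurability so
  that Fubini's theorem is available.\<close>
definition fint :: "('a::euclidean_space \<Rightarrow> complex) \<Rightarrow> 'a \<Rightarrow> complex" where
  "fint h x = (\<integral>y. h y * cis (x \<bullet> y) \<partial>lborel)"

lemma integrable_times_cis: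
  fixes h :: "'a::euclidean_space \<Rightarrow> complex"
  assumes "integrable lborel h"
  shows "integrable lborel (\<lambda>y. h y * cis (x \<bullet> y))"
  by (rule Bochner_Integration.integrable_bound[OF assms]) (use assms in \<open>auto simp: norm_mult\<close>)

lemma norm_fint_le: "norm (fint h x) \<le> (\<integral>y. norm (h y) \<partial>lborel)"
  unfolding fint_def using integral_norm_bound[of lborel "\<lambda>y. h y * cis (x \<bullet> y)"]
  by (simp add: norm_mult)

lemma continuous_fint:
  fixes h :: "'a::euclidean_space \<Rightarrow> complex"
  assumes h: "integrable lborel h"
  shows "continuous_on UNIV (fint h)"
proof (rule continuous_on_sequentiallyI)
  fix s a assume s: "s \<longlonglongrightarrow> (a::'a)"
  show "(\<lambda>n. fint h (s n)) \<longlonglongrightarrow> fint h a"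
    unfolding fint_def
  proof (rule integral_dominated_convergence[where w="\<lambda>y. norm (h y)"])
    show "AE y in lborel. (\<lambda>n. h y * cis (s n \<bullet> y)) \<longlonglongrightarrow> h y * cis (a \<bullet> y)"
      unfolding cis_conv_exp by (intro AE_I2 tendsto_intros s)
  qed (use h in \<open>auto simp: norm_mult\<close>)
qed

lemma fint_borel: "integrable lborel h \<Longrightarrow> fint h \<in> borel_measurable borel"
  by (intro borel_measurable_continuous_onI continuous_fint)

lemma schwartz_integrable:
  assumes "schwartz u"
  shows "integrable lborel u"
  using rapidly_decreasing_integrable(2) schwartz_rapidly_decreasing schwartz_borel assms by blast

lemma fourier_eq_fint:
  assumes "u \<in> borel_measurable borel"
  shows "fourier u \<xi> = fint u (- \<xi>)"
  unfolding fourier_def fint_def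
  by (subst integral_completion) (use assms in \<open>auto simp: inner_commute\<close>)

text \<open>Provides a majorant, uniform in \<open>t\<close>, for the difference quotients, as
  dominated convergence requires. The mean value inequality bounds them by the derivative at points
  within distance 1 of \<open>x\<close>; such a move changes \<open>1 + norm x\<close> by a factor
  of at most 2, whence the constant \<open>C * 2 ^ k\<close>.\<close>

lemma schwartz_diff_quotient_bound:
  fixes u :: "real ^ 'n \<Rightarrow> complex"
  assumes u: "schwartz u" and b: "b \<in> Basis"
  obtains C where "C > 0" "\<And>x t. 0 < t \<Longrightarrow> t \<le> 1 \<Longrightarrow>
    norm (u (x + t *\<^sub>R b) - u x) \<le> t * (C / (1 + norm x) ^ k)"
proof -
  have "schwartz (pderivs [b] u)" using u b by (intro schwartz_pderivs) auto
  then obtain C where C: "C > 0" "\<And>x. (1 + norm x) ^ k * cmod (pderivs [b] u x) \<le> C"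
    using rapidly_decreasingD schwartz_rapidly_decreasing by metis
  have "norm (u (x + t *\<^sub>R b) - u x) \<le> t * (C * 2 ^ k / (1 + norm x) ^ k)" if t: "0 < t" "t \<le> 1" for x t
  proof -
    have arith: "1 + p \<le> 2 * (1 + q)" if "p \<le> q + r" "r \<le> 1" "0 \<le> q" for p q r :: real
      using that by simp
    have px: "(1 + norm x) ^ k > 0" by (simp add: add_pos_nonneg)
    define D where "D = (\<lambda>s. pderivs [b] u (x + s *\<^sub>R b))"
    have der: "((\<lambda>s. u (x + s *\<^sub>R b)) has_derivative (\<lambda>h. h *\<^sub>R D s)) (at s within {0..t})" for s
    proof -
      have "((\<lambda>s. x + s *\<^sub>R b) has_derivative (\<lambda>h. h *\<^sub>R b)) (at s)"
        by (auto intro!: derivative_eq_intros)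
      from has_derivative_compose[OF this schwartz_has_derivative(1)[OF u]]
      have "((\<lambda>s. u (x + s *\<^sub>R b)) has_derivative (\<lambda>h. frechet_derivative u (at (x + s *\<^sub>R b)) (h *\<^sub>R b))) (at s)" .
      moreover have "frechet_derivative u (at (x + s *\<^sub>R b)) (h *\<^sub>R b) = h *\<^sub>R D s" for h
        using linear_scale[OF has_derivative_linear[OF schwartz_has_derivative(1)[OF u]]]
        by (simp only: D_def schwartz_has_derivative(2)[OF u])
      ultimately show ?thesis by (auto intro: has_derivative_at_withinI)
    qed
    have bd: "norm (D s) \<le> C * 2 ^ k / (1 + norm x) ^ k" if s: "s \<in> {0..t}" for s
    proof -
      have "norm x \<le> norm (x + s *\<^sub>R b) + norm (s *\<^sub>R b)"
        using norm_triangle_ineq4[of "x + s *\<^sub>R b" "s *\<^sub>R b"] by simp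
      moreover have "norm (s *\<^sub>R b) \<le> 1" using s t b by simp
      ultimately have "1 + norm x \<le> 2 * (1 + norm (x + s *\<^sub>R b))" using norm_ge_zero[of "x + s *\<^sub>R b"]
        by (rule arith)
      then have "(1 + norm x) ^ k \<le> (2 * (1 + norm (x + s *\<^sub>R b))) ^ k"
        by (intro power_mono) auto
      then have "(1 + norm x) ^ k * norm (D s) \<le> (2 ^ k * (1 + norm (x + s *\<^sub>R b)) ^ k) * norm (D s)"
        unfolding power_mult_distrib by (intro mult_right_mono) auto
      also have "\<dots> \<le> 2 ^ k * C"
        using mult_left_mono[OF C(2)[of "x + s *\<^sub>R b"], of "2 ^ k"] by (simp only: D_def mult.assoc) simp
      finally show ?thesis using px by (simp add: pos_le_divide_eq mult_ac)
    qed
    have "norm (u (x + t *\<^sub>R b) - u (x + 0 *\<^sub>R b)) \<le> (C * 2 ^ k / (1 + norm x) ^ k) * norm (t - 0)"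
    proof (rule differentiable_bound[OF convex_real_interval(5)[of 0 t] der])
      fix s assume "s \<in> {0..t}"
      then show "onorm (\<lambda>h. h *\<^sub>R D s) \<le> C * 2 ^ k / (1 + norm x) ^ k"
        using mult_right_mono[OF bd[of s]] by (intro onorm_le) (simp add: mult.commute)
    qed (use t in auto)
    then show ?thesis using t by (simp add: mult.commute)
  qed
  then show thesis using C(1) by (intro that[of "C * 2 ^ k"]) auto
qed

lemma fint_translate:
  fixes u :: "'a::euclidean_space \<Rightarrow> complex"
  assumes u: "integrable lborel u"
  shows "(\<integral>y. u (y + b) * cis (x \<bullet> y) \<partial>lborel) = cis (- (x \<bullet> b)) * fint u x"
proof -
  have "(\<integral>y. u (y + b) * cis (x \<bullet> y) \<partial>lborel) = (\<integral>y. (\<lambda>y. cis (- (x \<bullet> b)) * (u y * cis (x \<bullet> y))) (y + b) \<partial>lborel)"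
    by (intro Bochner_Integration.integral_cong refl) (simp add: inner_add_right cis_mult mult.left_commute)
  also have "\<dots> = (\<integral>y. cis (- (x \<bullet> b)) * (u y * cis (x \<bullet> y)) \<partial>lborel)"
    by (rule integral_lborel_translate) (use u in auto)
  finally show ?thesis by (simp add: fint_def)
qed

lemma has_vector_derivative_quotient:
  assumes "(f has_vector_derivative d) (at 0)"
  shows "((\<lambda>t. (f t - f 0) /\<^sub>R t) \<longlongrightarrow> d) (at 0)"
proof -
  have "((\<lambda>t. norm (f t - f 0 - t *\<^sub>R d) / norm t) \<longlongrightarrow> 0) (at 0)"
    using assms by (simp add: has_vector_derivative_def has_derivative_iff_norm)
  moreover have "\<forall>\<^sub>F t in at 0. norm (f t - f 0 - t *\<^sub>R d) / norm t = norm ((f t - f 0) /\<^sub>R t - d)"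
  proof (rule eventually_at_filter[THEN iffD2], intro always_eventually allI impI)
    fix t :: real assume t: "t \<noteq> 0"
    then have "(f t - f 0) /\<^sub>R t - d = (f t - f 0 - t *\<^sub>R d) /\<^sub>R t"
      by (simp add: scaleR_diff_right)
    then show "norm (f t - f 0 - t *\<^sub>R d) / norm t = norm ((f t - f 0) /\<^sub>R t - d)"
      by (simp add: divide_inverse mult.commute)
  qed
  ultimately have "((\<lambda>t. norm ((f t - f 0) /\<^sub>R t - d)) \<longlongrightarrow> 0) (at 0)"
    by (rule Lim_transform_eventually)
  then show ?thesis by (simp only: tendsto_norm_zero_iff LIM_zero_iff)
qed

text \<open>The transforms of the difference quotients are evaluated in two ways and the limits
  compared. The minus sign reflects the kernel \<open>cis (x \<bullet> y)\<close> with a positive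
  phase.\<close>

lemma fint_pderivs:
  fixes u :: "real ^ 'n \<Rightarrow> complex"
  assumes u: "schwartz u" and b: "b \<in> Basis"
  shows "fint (pderivs [b] u) x = - \<i> * of_real (x \<bullet> b) * fint u x"
proof -
  define e where "e n = 1 / real (Suc n)" for n
  have e0: "e n > 0" "e n \<le> 1" for n by (auto simp: e_def)
  have elim: "e \<longlonglongrightarrow> 0" unfolding e_def using LIMSEQ_inverse_real_of_nat by (simp add: inverse_eq_divide)
  have ui: "integrable lborel u" using schwartz_integrable[OF u] .
  have eat: "filterlim e (at 0) sequentially"
    using elim e0(1) by (auto simp: filterlim_at less_imp_neq[symmetric] intro!: always_eventually)
  obtain C where C: "C > 0" "\<And>x t. 0 < t \<Longrightarrow> t \<le> 1 \<Longrightarrow>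
    norm (u (x + t *\<^sub>R b) - u x) \<le> t * (C / (1 + norm x) ^ (2 * DIM(real ^ 'n)))"
    using schwartz_diff_quotient_bound[OF u b] by blast
  have [measurable]: "u \<in> borel_measurable borel" "pderivs [b] u \<in> borel_measurable borel"
    using u b schwartz_pderivs[OF u, of "[b]"] by (auto simp del: pderivs.simps intro: schwartz_borel)
  have "(\<lambda>n. \<integral>y. ((u (y + e n *\<^sub>R b) - u y) /\<^sub>R e n) * cis (x \<bullet> y) \<partial>lborel) \<longlonglongrightarrow> fint (pderivs [b] u) x"
    unfolding fint_def
  proof (rule integral_dominated_convergence[where w="\<lambda>y. C * (1 / (1 + norm y) ^ (2 * DIM(real ^ 'n)))"])
    show "integrable lborel (\<lambda>y::real ^ 'n. C * (1 / (1 + norm y) ^ (2 * DIM(real ^ 'n))))"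
      by (intro integrable_mult_right integrable_inverse_power_norm)
    show "AE y in lborel. norm (((u (y + e n *\<^sub>R b) - u y) /\<^sub>R e n) * cis (x \<bullet> y)) \<le> C * (1 / (1 + norm y) ^ (2 * DIM(real ^ 'n)))" for n
    proof (rule AE_I2)
      fix y :: "real ^ 'n"
      show "norm (((u (y + e n *\<^sub>R b) - u y) /\<^sub>R e n) * cis (x \<bullet> y)) \<le> C * (1 / (1 + norm y) ^ (2 * DIM(real ^ 'n)))"
        using C(2)[OF e0, of y n] e0(1)[of n]
        by (simp add: norm_mult divide_inverse_commute[of "cmod _" "e n", symmetric] pos_divide_le_eq mult.commute)
    qed
    show "AE y in lborel. (\<lambda>n. ((u (y + e n *\<^sub>R b) - u y) /\<^sub>R e n) * cis (x \<bullet> y)) \<longlonglongrightarrow> pderivs [b] u y * cis (x \<bullet> y)"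
    proof (intro AE_I2 tendsto_mult tendsto_const)
      fix y
      have "((\<lambda>t. y + t *\<^sub>R b) has_derivative (\<lambda>t. t *\<^sub>R b)) (at 0)"
        by (auto intro!: derivative_eq_intros)
      moreover have "(u has_derivative frechet_derivative u (at y)) (at (y + 0 *\<^sub>R b))"
        using schwartz_has_derivative(1)[OF u] by simp
      ultimately have "((\<lambda>t. u (y + t *\<^sub>R b)) has_derivative (\<lambda>t. frechet_derivative u (at y) (t *\<^sub>R b))) (at 0)"
        by (rule has_derivative_compose)
      then have "((\<lambda>t. u (y + t *\<^sub>R b)) has_vector_derivative pderivs [b] u y) (at 0)"
        using linear_scale[OF has_derivative_linear[OF schwartz_has_derivative(1)[OF u]]]
        unfolding has_vector_derivative_def schwartz_has_derivative(2)[OF u] by simp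
      then have "((\<lambda>t. (u (y + t *\<^sub>R b) - u y) /\<^sub>R t) \<longlongrightarrow> pderivs [b] u y) (at 0)"
        using has_vector_derivative_quotient by fastforce
      then show "(\<lambda>n. (u (y + e n *\<^sub>R b) - u y) /\<^sub>R e n) \<longlonglongrightarrow> pderivs [b] u y"
        by (rule filterlim_compose[OF _ eat])
    qed
  qed measurable
  \<comment> \<open>By translation invariance the transform of a difference quotient is explicit; this replaces integration by parts.\<close>
  moreover have "(\<integral>y. ((u (y + e n *\<^sub>R b) - u y) /\<^sub>R e n) * cis (x \<bullet> y) \<partial>lborel)
      = ((cis (- (x \<bullet> b) * e n) - 1) /\<^sub>R e n) * fint u x" for n
  proof -
    have i1: "integrable lborel (\<lambda>y. u (y + e n *\<^sub>R b) * cis (x \<bullet> y))"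
      by (intro integrable_times_cis integrable_lborel_translate ui)
    have "(\<integral>y. ((u (y + e n *\<^sub>R b) - u y) /\<^sub>R e n) * cis (x \<bullet> y) \<partial>lborel) =
      (\<integral>y. (u (y + e n *\<^sub>R b) * cis (x \<bullet> y) - u y * cis (x \<bullet> y)) /\<^sub>R e n \<partial>lborel)"
      by (simp add: algebra_simps)
    also have "\<dots> = (cis (- (x \<bullet> (e n *\<^sub>R b))) * fint u x - fint u x) /\<^sub>R e n"
      by (subst integral_scaleR_right, subst Bochner_Integration.integral_diff[OF i1 integrable_times_cis[OF ui]])
        (simp add: fint_translate[OF ui] flip: fint_def)
    finally show ?thesis by (simp add: algebra_simps)
  qed
  moreover have "(\<lambda>n. ((cis (- (x \<bullet> b) * e n) - 1) /\<^sub>R e n) * fint u x) \<longlonglongrightarrow> (- \<i> * of_real (x \<bullet> b)) * fint u x"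
  proof (intro tendsto_mult tendsto_const)
    have "((\<lambda>t. cis (- (x \<bullet> b) * t)) has_vector_derivative (- \<i> * of_real (x \<bullet> b))) (at 0)"
    proof -
      have "((\<lambda>z. exp (- \<i> * of_real (x \<bullet> b) * z)) has_field_derivative (- \<i> * of_real (x \<bullet> b))) (at (of_real 0))"
        by (auto intro!: derivative_eq_intros)
      from has_vector_derivative_real_field[OF this] show ?thesis
        by (simp add: cis_conv_exp mult.assoc)
    qed
    then have "((\<lambda>t. (cis (- (x \<bullet> b) * t) - 1) /\<^sub>R t) \<longlongrightarrow> - \<i> * of_real (x \<bullet> b)) (at 0)"
      using has_vector_derivative_quotient by fastforce
    then show "(\<lambda>n. (cis (- (x \<bullet> b) * e n) - 1) /\<^sub>R e n) \<longlonglongrightarrow> - \<i> * of_real (x \<bullet> b)"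
      by (rule filterlim_compose[OF _ eat])
  qed
  ultimately show ?thesis by (simp only: LIMSEQ_unique)
qed

text \<open>Each power of the norm is bounded by the sum of the absolute coordinates, and each
  coordinate is traded for a partial derivative of \<open>u\<close>. Since the induction hypothesis
  is applied to these derivatives, \<open>u\<close> has to vary.\<close>

lemma rapidly_decreasing_fint:
  fixes u :: "real ^ 'n \<Rightarrow> complex"
  assumes "schwartz u"
  shows "rapidly_decreasing (fint u)"
proof (rule rapidly_decreasingI)
  fix m
  show "\<exists>C. \<forall>x. (1 + norm x) ^ m * cmod (fint u x) \<le> C"
    using assms
  proof (induction m arbitrary: u)
    case 0
    then show ?case using norm_fint_le by auto
  next
    case (Suc m)
    obtain C0 where C0: "\<And>x. (1 + norm x) ^ m * cmod (fint u x) \<le> C0" using Suc by blast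
    have "\<forall>b\<in>Basis. \<exists>C. \<forall>x. (1 + norm x) ^ m * cmod (fint (pderivs [b] u) x) \<le> C"
      using Suc.IH schwartz_pderivs[OF Suc.prems] by (simp del: pderivs.simps)
    then obtain C where C: "\<And>b x. b \<in> Basis \<Longrightarrow> (1 + norm x) ^ m * cmod (fint (pderivs [b] u) x) \<le> C b"
      by metis
    have "(1 + norm x) ^ Suc m * cmod (fint u x) \<le> C0 + (\<Sum>b\<in>Basis. C b)" for x
    proof -
      have "norm x * cmod (fint u x) \<le> (\<Sum>b\<in>Basis. \<bar>x \<bullet> b\<bar>) * cmod (fint u x)"
        by (intro mult_right_mono norm_le_l1) auto
      also have "\<dots> = (\<Sum>b\<in>Basis. cmod (fint (pderivs [b] u) x))"
        unfolding sum_distrib_right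
        by (intro sum.cong refl, subst fint_pderivs[OF Suc.prems]) (auto simp: norm_mult)
      finally have "(1 + norm x) ^ m * (norm x * cmod (fint u x)) \<le> (\<Sum>b\<in>Basis. (1 + norm x) ^ m * cmod (fint (pderivs [b] u) x))"
        by (simp add: sum_distrib_left[symmetric] mult_left_mono del: pderivs.simps)
      also have "\<dots> \<le> (\<Sum>b\<in>Basis. C b)" by (intro sum_mono C)
      finally show ?thesis using C0[of x] by (simp add: algebra_simps)
    qed
    then show ?case by blast
  qed
qed

section \<open>Inverse Fourier transforms of functions with all moments\<close>

text \<open>This is the integrability consumed by differentiation under the integral sign. It asks
  for no regularity and hence survives multiplication by bounded measurable symbols.\<close>

definition all_moments :: "('a::euclidean_space \<Rightarrow> complex) \<Rightarrow> bool" where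
  "all_moments h \<longleftrightarrow> h \<in> borel_measurable borel \<and>
     (\<forall>k::nat. integrable lborel (\<lambda>y. (1 + norm y) ^ k * norm (h y)))"

lemma all_moments_integrable:
  assumes "all_moments h"
  shows "integrable lborel h"
  using assms[unfolded all_moments_def, THEN conjunct2, rule_format, of 0] assms
  by (simp add: all_moments_def integrable_norm_iff)

text \<open>Linear growth costs one moment. Admitting it lets one lemma serve both bounded symbols
  and the factors \<open>y \<bullet> v\<close> created by differentiation.\<close>

lemma all_moments_mult:
  assumes h: "all_moments h" and q: "q \<in> borel_measurable borel" "\<And>y. norm (q y) \<le> C * (1 + norm y)"
  shows "all_moments (\<lambda>y. q y * h y)"
  unfolding all_moments_def
proof (intro conjI allI)
  have [measurable]: "h \<in> borel_measurable borel" "q \<in> borel_measurable borel"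
    using h q by (auto simp: all_moments_def)
  show "(\<lambda>y. q y * h y) \<in> borel_measurable borel" by measurable
  fix k
  have i: "integrable lborel (\<lambda>y. C * ((1 + norm y) ^ Suc k * norm (h y)))"
    using h unfolding all_moments_def by (intro integrable_mult_right) blast
  show "integrable lborel (\<lambda>y. (1 + norm y) ^ k * norm (q y * h y))"
  proof (rule Bochner_Integration.integrable_bound[OF i])
    show "AE y in lborel. norm ((1 + norm y) ^ k * norm (q y * h y)) \<le> norm (C * ((1 + norm y) ^ Suc k * norm (h y)))"
    proof (rule AE_I2)
      fix y
      have "(1 + norm y) ^ k * norm (q y * h y) = ((1 + norm y) ^ k * norm (h y)) * norm (q y)"
        by (simp add: norm_mult mult_ac)
      also have "\<dots> \<le> ((1 + norm y) ^ k * norm (h y)) * (C * (1 + norm y))"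
        by (intro mult_left_mono q) auto
      also have "\<dots> = C * ((1 + norm y) ^ Suc k * norm (h y))" by (simp add: mult_ac)
      finally show "norm ((1 + norm y) ^ k * norm (q y * h y)) \<le> norm (C * ((1 + norm y) ^ Suc k * norm (h y)))"
        by simp
    qed
  qed measurable
qed

lemma all_moments_inner:
  assumes "all_moments h"
  shows "all_moments (\<lambda>y. \<i> * of_real (y \<bullet> v) * h y)"
proof (rule all_moments_mult[OF assms, where C="norm v"])
  fix y
  have "\<bar>y \<bullet> v\<bar> \<le> norm y * norm v" by (rule Cauchy_Schwarz_ineq2)
  then show "norm (\<i> * complex_of_real (y \<bullet> v)) \<le> norm v * (1 + norm y)"
    by (simp add: norm_mult algebra_simps add_increasing)
qed measurable

text \<open>The first-order remainder is quadratic in \<open>z - x\<close>, with the second moment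
  of \<open>h\<close> as its constant, because \<open>cis \<theta> - 1 - \<i> * \<theta>\<close> is
  at most \<theta> squared. The derivative is total, as the closure argument for
  \<open>polyspan\<close> needs it.\<close>

lemma fint_has_derivative:
  fixes h :: "'a::euclidean_space \<Rightarrow> complex"
  assumes h: "all_moments h"
  shows "(fint h has_derivative (\<lambda>v. fint (\<lambda>y. \<i> * of_real (y \<bullet> v) * h y) x)) (at x)"
proof -
  have [measurable]: "h \<in> borel_measurable borel" using h by (simp add: all_moments_def)
  define D where "D = (\<lambda>v. fint (\<lambda>y. \<i> * of_real (y \<bullet> v) * h y) x)"
  have Di: "integrable lborel (\<lambda>y. \<i> * of_real (y \<bullet> v) * h y * cis (x \<bullet> y))" for v
    by (intro integrable_times_cis all_moments_integrable all_moments_inner h)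
  have m1: "integrable lborel (\<lambda>y. norm y ^ k * norm (h y))" for k
  proof (rule Bochner_Integration.integrable_bound)
    show "integrable lborel (\<lambda>y. (1 + norm y) ^ k * norm (h y))" using h by (auto simp: all_moments_def)
  qed (auto intro!: mult_right_mono power_mono)
  have "bounded_linear D"
  proof (rule bounded_linear_intro[where K="\<integral>y. norm y ^ 1 * norm (h y) \<partial>lborel"])
    fix v w
    have "D (v + w) = (\<integral>y. \<i> * of_real (y \<bullet> v) * h y * cis (x \<bullet> y) + \<i> * of_real (y \<bullet> w) * h y * cis (x \<bullet> y) \<partial>lborel)"
      unfolding D_def fint_def by (intro Bochner_Integration.integral_cong refl) (simp add: inner_add_right algebra_simps)
    then show "D (v + w) = D v + D w"
      unfolding D_def fint_def by (simp add: Bochner_Integration.integral_add[OF Di Di])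
  next
    fix r v
    have "D (r *\<^sub>R v) = (\<integral>y. r *\<^sub>R (\<i> * of_real (y \<bullet> v) * h y * cis (x \<bullet> y)) \<partial>lborel)"
      unfolding D_def fint_def by (intro Bochner_Integration.integral_cong refl) (simp add: scaleR_conv_of_real)
    then show "D (r *\<^sub>R v) = r *\<^sub>R D v"
      unfolding D_def fint_def by simp
  next
    fix v
    have "norm (D v) \<le> (\<integral>y. norm (\<i> * of_real (y \<bullet> v) * h y) \<partial>lborel)"
      unfolding D_def by (rule norm_fint_le)
    also have "\<dots> \<le> (\<integral>y. norm v * (norm y ^ 1 * norm (h y)) \<partial>lborel)"
    proof (rule integral_mono)
      show "integrable lborel (\<lambda>y. norm (\<i> * of_real (y \<bullet> v) * h y))"
        by (intro integrable_norm all_moments_integrable all_moments_inner h)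
      show "integrable lborel (\<lambda>y. norm v * (norm y ^ 1 * norm (h y)))" by (intro integrable_mult_right m1)
      fix y
      have "\<bar>y \<bullet> v\<bar> * norm (h y) \<le> norm y * norm v * norm (h y)"
        by (intro mult_right_mono Cauchy_Schwarz_ineq2) auto
      then show "norm (\<i> * of_real (y \<bullet> v) * h y) \<le> norm v * (norm y ^ 1 * norm (h y))"
        by (simp add: norm_mult mult_ac)
    qed
    finally show "norm (D v) \<le> norm v * (\<integral>y. norm y ^ 1 * norm (h y) \<partial>lborel)" by simp
  qed
  moreover have "((\<lambda>z. norm ((fint h z - fint h x) - D (z - x)) / norm (z - x)) \<longlongrightarrow> 0) (at x)"
  proof -
    define K where "K = (\<integral>y. norm y ^ 2 * norm (h y) \<partial>lborel)"
    have bd: "norm ((fint h z - fint h x) - D (z - x)) \<le> K * (norm (z - x))\<^sup>2" for z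
    proof -
      have hi: "integrable lborel (\<lambda>y. h y * cis (w \<bullet> y))" for w
        by (intro integrable_times_cis all_moments_integrable h)
      \<comment> \<open>Taking the phase \<open>cis (x \<bullet> y)\<close> out of this integrand
        leaves the Taylor remainder of \<open>cis\<close> at the angle
        \<open>y \<bullet> (z - x)\<close>.\<close>
      define R where "R = (\<lambda>y. h y * cis (z \<bullet> y) - h y * cis (x \<bullet> y) - \<i> * of_real (y \<bullet> (z - x)) * h y * cis (x \<bullet> y))"
      have "(fint h z - fint h x) - D (z - x)
        = (\<integral>y. R y \<partial>lborel)"
        unfolding R_def D_def fint_def
        using Bochner_Integration.integral_diff[OF Bochner_Integration.integrable_diff[OF hi[of z] hi[of x]] Di[of "z - x"]]
          Bochner_Integration.integral_diff[OF hi[of z] hi[of x]] by simp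
      then have "norm ((fint h z - fint h x) - D (z - x)) \<le> (\<integral>y. norm (R y) \<partial>lborel)"
        using integral_norm_bound[of lborel R] by (simp only:)
      also have "\<dots> \<le> (\<integral>y. (norm (z - x))\<^sup>2 * (norm y ^ 2 * norm (h y)) \<partial>lborel)"
      proof (rule integral_mono)
        show "integrable lborel (\<lambda>y. norm (R y))"
          unfolding R_def by (intro integrable_norm Bochner_Integration.integrable_diff hi Di)
        show "integrable lborel (\<lambda>y. (norm (z - x))\<^sup>2 * (norm y ^ 2 * norm (h y)))"
          by (intro integrable_mult_right m1)
        fix y
        define \<theta> where "\<theta> = y \<bullet> (z - x)"
        have "R y = h y * cis (x \<bullet> y) * (cis \<theta> - 1 - \<i> * of_real \<theta>)"
          by (simp add: R_def \<theta>_def algebra_simps inner_diff_right inner_commute cis_mult)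
        then have "norm (R y)
           = norm (h y) * norm (cis \<theta> - 1 - \<i> * of_real \<theta>)"
          by (simp add: norm_mult)
        moreover have "norm (cis \<theta> - 1 - \<i> * of_real \<theta>) \<le> (norm y * norm (z - x))\<^sup>2"
        proof -
          have "norm (cis \<theta> - 1 - \<i> * of_real \<theta>) \<le> \<theta>\<^sup>2 / 2"
          using iexp_approx1[of \<theta> 1] by (simp add: cis_conv_exp diff_diff_eq power2_eq_square)
          also have "\<theta>\<^sup>2 / 2 \<le> \<theta>\<^sup>2" by simp
          also have "\<theta>\<^sup>2 \<le> (norm y * norm (z - x))\<^sup>2"
          unfolding \<theta>_def using Cauchy_Schwarz_ineq2[of y "z - x"] by (simp flip: abs_le_square_iff)
          finally show ?thesis .
        qed
        ultimately have "norm (R y) \<le> norm (h y) * (norm y * norm (z - x))\<^sup>2"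
          by (simp add: mult_left_mono)
        then show "norm (R y) \<le> (norm (z - x))\<^sup>2 * (norm y ^ 2 * norm (h y))"
          by (simp add: power_mult_distrib mult_ac)
      qed
      finally show ?thesis by (simp add: K_def mult.commute)
    qed
    have K0: "K \<ge> 0" unfolding K_def by simp
    show ?thesis
    proof (rule tendsto_sandwich[OF _ _ tendsto_const])
      show "\<forall>\<^sub>F z in at x. norm ((fint h z - fint h x) - D (z - x)) / norm (z - x) \<le> K * norm (z - x)"
      proof (intro always_eventually allI)
        fix z
        show "norm ((fint h z - fint h x) - D (z - x)) / norm (z - x) \<le> K * norm (z - x)"
          using bd[of z] K0 by (cases "z = x") (auto simp: pos_divide_le_eq power2_eq_square mult.assoc)
      qed
      have "((\<lambda>z. K * norm (z - x)) \<longlongrightarrow> K * norm (x - x)) (at x)" by (intro tendsto_intros)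
      then show "((\<lambda>z. K * norm (z - x)) \<longlongrightarrow> 0) (at x)" by simp
    qed auto
  qed
  ultimately show ?thesis unfolding has_derivative_iff_norm D_def by blast
qed

text \<open>A single term of the exponential series is at most its sum. It is used for the decay of
  Gaussians and for the flatness of exp(-1/t) at 0.\<close>

lemma power_le_fact_exp: "s ^ k \<le> fact k * exp s" if "s \<ge> 0" for s :: real
proof -
  have "(\<Sum>n\<in>{k}. s ^ n /\<^sub>R fact n) \<le> (\<Sum>n. s ^ n /\<^sub>R fact n)"
    using summable_exp_generic[of s] that by (intro sum_le_suminf) auto
  then show ?thesis by (simp add: exp_def divide_inverse_commute[symmetric] pos_divide_le_eq mult.commute)
qed

text \<open>The power is first replaced by \<open>fact m * exp (1 + r)\<close>; completing the
  square then bounds the remaining exponent \<open>1 + r - (e * r)\<^sup>2 / 2\<close>.\<close>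

lemma rapidly_decreasing_gaussian:
  fixes f :: "'a::real_inner \<Rightarrow> complex"
  assumes e: "e > 0" and f: "\<And>x. norm (f x) \<le> K"
  shows "rapidly_decreasing (\<lambda>x. f x * of_real (exp (- (e * norm x)\<^sup>2 / 2)))"
proof (rule rapidly_decreasingI)
  fix m
  have "(1 + norm x) ^ m * cmod (f x * of_real (exp (- (e * norm x)\<^sup>2 / 2))) \<le> K * (fact m * exp (1 + 1 / (2 * e\<^sup>2)))" for x
  proof -
    define r where "r = norm x"
    have r: "r \<ge> 0" by (simp add: r_def)
    \<comment> \<open>This square has the cross term \<open>2 * r\<close>, so it controls the linear
      exponent by the quadratic one with constant \<open>1 / e\<^sup>2\<close>.\<close>
    have "0 \<le> (e * r - 1 / e)\<^sup>2" by simp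
    then have "2 * r - (e * r)\<^sup>2 \<le> 1 / e\<^sup>2" using e by (simp add: power2_diff power_divide)
    then have le: "1 + r - (e * r)\<^sup>2 / 2 \<le> 1 + 1 / (2 * e\<^sup>2)" by (simp add: field_simps)
    have "(1 + r) ^ m * exp (- (e * r)\<^sup>2 / 2) \<le> (fact m * exp (1 + r)) * exp (- (e * r)\<^sup>2 / 2)"
      using r by (intro mult_right_mono power_le_fact_exp) auto
    also have "\<dots> = fact m * exp (1 + r - (e * r)\<^sup>2 / 2)"
      by (simp add: mult.assoc flip: exp_add)
    also have "\<dots> \<le> fact m * exp (1 + 1 / (2 * e\<^sup>2))" using le by simp
    finally have "cmod (f x) * ((1 + r) ^ m * exp (- (e * r)\<^sup>2 / 2)) \<le> K * (fact m * exp (1 + 1 / (2 * e\<^sup>2)))"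
      using order_trans[OF norm_ge_zero f[of x]] r by (intro mult_mono[OF f[of x]]) auto
    then show ?thesis by (simp add: norm_mult r_def mult_ac)
  qed
  then show "\<exists>C. \<forall>x. (1 + norm x) ^ m * cmod (f x * of_real (exp (- (e * norm x)\<^sup>2 / 2))) \<le> C" by blast
qed

text \<open>With \<open>e\<close> fixed and \<open>h\<close> ranging over all functions with
  moments, the products form a family fit for \<open>polyspan\<close>: differentiating the Gaussian
  yields a coordinate factor, differentiating \<open>fint h\<close> replaces \<open>h\<close> by
  \<open>h\<close> times a coordinate, which again has all moments.\<close>

lemma schwartz_fint_gaussian:
  fixes h :: "real ^ 'n \<Rightarrow> complex"
  assumes h: "all_moments h" and e: "e > 0"
  shows "schwartz (\<lambda>x. fint h x * of_real (exp (- (e * norm x)\<^sup>2 / 2)))"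
proof -
  define \<gamma> where "\<gamma> = (\<lambda>x::real ^ 'n. complex_of_real (exp (- (e * norm x)\<^sup>2 / 2)))"
  define B where "B = {(\<lambda>x. fint h x * \<gamma> x) |h::real ^ 'n \<Rightarrow> complex. all_moments h}"
  have \<gamma>': "(\<gamma> has_derivative (\<lambda>v. - of_real (e\<^sup>2 * (x \<bullet> v)) * \<gamma> x)) (at x)" for x
  proof -
    have "((\<lambda>x. exp (- (e\<^sup>2 * (x \<bullet> x)) / 2)) has_derivative (\<lambda>v. - (e\<^sup>2 * (x \<bullet> v)) * exp (- (e\<^sup>2 * (x \<bullet> x)) / 2))) (at x)"
      by (auto intro!: derivative_eq_intros simp: inner_commute)
    from has_derivative_of_real[OF this] show ?thesis
      by (simp add: \<gamma>_def power_mult_distrib power2_norm_eq_inner)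
  qed
  have "polyspan B (\<lambda>x. fint h x * \<gamma> x)"
    using h by (intro polyspan.base) (auto simp: B_def)
  then have "schwartz (\<lambda>x. fint h x * \<gamma> x)"
  proof (rule polyspan_schwartz[rotated])
    fix f assume "f \<in> B"
    then obtain h where h: "all_moments h" and f: "f = (\<lambda>x. fint h x * \<gamma> x)" by (auto simp: B_def)
    define D where "D = (\<lambda>x v. fint h x * (- of_real (e\<^sup>2 * (x \<bullet> v)) * \<gamma> x) + fint (\<lambda>y. \<i> * of_real (y \<bullet> v) * h y) x * \<gamma> x)"
    have "(f has_derivative D x) (at x)" for x
      unfolding f D_def by (rule has_derivative_mult[OF fint_has_derivative[OF h] \<gamma>'])
    moreover have "polyspan B (\<lambda>x. D x b)" if b: "b \<in> Basis" for b
    proof -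
      have 1: "polyspan B (\<lambda>x. fint h x * \<gamma> x)"
        using h by (intro polyspan.base) (auto simp: B_def)
      have 2: "polyspan B (\<lambda>x. fint (\<lambda>y. \<i> * of_real (y \<bullet> b) * h y) x * \<gamma> x)"
        using all_moments_inner[OF h, of b] by (intro polyspan.base) (auto simp: B_def)
      have "polyspan B (\<lambda>x. - of_real (e\<^sup>2) * (of_real (x \<bullet> b) * (fint h x * \<gamma> x)) + fint (\<lambda>y. \<i> * of_real (y \<bullet> b) * h y) x * \<gamma> x)"
        by (intro polyspan.add polyspan.scale polyspan.coord b 1 2)
      then show ?thesis by (simp add: D_def mult_ac)
    qed
    moreover have "rapidly_decreasing f"
      unfolding f \<gamma>_def by (rule rapidly_decreasing_gaussian[OF e norm_fint_le])
    ultimately show "rapidly_decreasing f \<and>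
     (\<exists>D. (\<forall>x. (f has_derivative D x) (at x)) \<and> (\<forall>b\<in>Basis. polyspan B (\<lambda>x. D x b)))"
      by blast
  qed
  then show ?thesis by (simp add: \<gamma>_def)
qed

section \<open>Bump functions\<close>

text \<open>The case \<open>k = 0\<close> is the classical smooth function exp(-1/t) that is flat at
  0. The powers of \<open>inverse t\<close> are included because differentiation produces them,
  which makes the family closed under it up to linear combinations.\<close>

definition flat :: "nat \<Rightarrow> real \<Rightarrow> real" where
  "flat k t = (if t > 0 then inverse t ^ k * exp (- inverse t) else 0)"

lemma flat_nonneg: "flat k t \<ge> 0"
  by (simp add: flat_def)

lemma flat_le: "flat k t \<le> fact k"
proof (cases "t > 0")
  case True
  then have "inverse t ^ k * exp (- inverse t) \<le> (fact k * exp (inverse t)) * exp (- inverse t)"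
    by (intro mult_right_mono power_le_fact_exp) auto
  then show ?thesis using True by (simp add: flat_def mult.assoc flip: exp_add)
qed (simp add: flat_def)

text \<open>Away from 0 this is the product rule. At 0 the difference quotient for positive
  \<open>h\<close> equals \<open>flat (k + 2) h * h\<close>, which is at most
  \<open>fact (k + 2) * h\<close>, so the derivative there is 0.\<close>

lemma flat_has_real_derivative:
  "(flat k has_real_derivative flat (k + 2) t - real k * flat (k + 1) t) (at t)"
proof -
  consider "t > 0" | "t < 0" | "t = 0" by linarith
  then show ?thesis
  proof cases
    case 1
    have "((\<lambda>t. inverse t ^ k) has_real_derivative - real k * inverse t ^ (k + 1)) (at t)"
    proof (induction k)
      case (Suc k)
      have "((\<lambda>t. inverse t * inverse t ^ k) has_real_derivative
          - (inverse t)\<^sup>2 * inverse t ^ k + - real k * inverse t ^ (k + 1) * inverse t) (at t)"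
        by (rule DERIV_mult[OF _ Suc]) (use 1 in \<open>auto intro!: derivative_eq_intros simp: power2_eq_square\<close>)
      then show ?case by (simp add: algebra_simps power2_eq_square)
    qed simp
    moreover have "((\<lambda>t. exp (- inverse t)) has_real_derivative exp (- inverse t) * (inverse t)\<^sup>2) (at t)"
      using 1 by (auto intro!: derivative_eq_intros simp: power2_eq_square)
    ultimately have "((\<lambda>t. inverse t ^ k * exp (- inverse t)) has_real_derivative
        - real k * inverse t ^ (k + 1) * exp (- inverse t) + exp (- inverse t) * (inverse t)\<^sup>2 * inverse t ^ k) (at t)"
      by (rule DERIV_mult)
    then have "((\<lambda>t. inverse t ^ k * exp (- inverse t)) has_real_derivative flat (k + 2) t - real k * flat (k + 1) t) (at t)"
      using 1 by (simp add: flat_def algebra_simps power2_eq_square)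
    then show ?thesis
      by (rule has_field_derivative_transform_within_open[where S="{0<..}"]) (use 1 in \<open>auto simp: flat_def\<close>)
  next
    case 2
    have "((\<lambda>t. 0) has_real_derivative flat (k + 2) t - real k * flat (k + 1) t) (at t)"
      using 2 by (simp add: flat_def)
    then show ?thesis
      by (rule has_field_derivative_transform_within_open[where S="{..<0}"]) (use 2 in \<open>auto simp: flat_def\<close>)
  next
    case 3
    have "((\<lambda>h. (flat k (0 + h) - flat k 0) / h) \<longlongrightarrow> 0) (at 0)"
    proof (rule Lim_null_comparison)
      show "\<forall>\<^sub>F h in at 0. norm ((flat k (0 + h) - flat k 0) / h) \<le> fact (k + 2) * \<bar>h\<bar>"
      proof (intro always_eventually allI)
        fix h :: real
        show "norm ((flat k (0 + h) - flat k 0) / h) \<le> fact (k + 2) * \<bar>h\<bar>"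
        proof (cases "h > 0")
          case True
          then have "norm ((flat k (0 + h) - flat k 0) / h) = flat (k + 2) h * h"
            by (simp add: flat_def divide_inverse)
          also have "\<dots> \<le> fact (k + 2) * h" using True by (intro mult_right_mono flat_le) auto
          finally show ?thesis using True by simp
        next
          case False
          then have "norm ((flat k (0 + h) - flat k 0) / h) = 0" by (simp add: flat_def)
          then show ?thesis by (metis abs_ge_zero fact_ge_zero mult_nonneg_nonneg)
        qed
      qed
      have "((\<lambda>h::real. fact (k + 2) * \<bar>h\<bar>) \<longlongrightarrow> fact (k + 2) * \<bar>0\<bar>) (at 0)" by (intro tendsto_intros)
      then show "((\<lambda>h::real. fact (k + 2) * \<bar>h\<bar>) \<longlongrightarrow> 0) (at 0)" by simp
    qed
    then show ?thesis using 3 by (simp add: DERIV_def flat_def)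
  qed
qed

text \<open>The derivatives of \<open>bump 0\<close> are polynomial combinations of the functions \<open>bump k\<close>.\<close>
definition bump :: "nat \<Rightarrow> 'a::real_inner \<Rightarrow> real" where
  "bump k x = flat k (1 - x \<bullet> x)"

lemma bump_nonneg: "bump k x \<ge> 0"
  by (simp add: bump_def flat_nonneg)

lemma bump_le: "bump k x \<le> fact k * indicator (cball 0 1) x"
proof (cases "norm x \<le> 1")
  case True
  then show ?thesis by (simp add: bump_def flat_le)
next
  case False
  then have "x \<bullet> x > 1" by (simp add: norm_eq_sqrt_inner)
  then show ?thesis using False by (simp add: bump_def flat_def)
qed

lemma bump_pos: "norm x < 1 \<Longrightarrow> bump 0 x > 0"
  by (simp add: bump_def flat_def norm_eq_sqrt_inner)

lemma rapidly_decreasing_bump: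
  assumes "\<And>x. norm (q x) = 1"
  shows "rapidly_decreasing (\<lambda>x. of_real (bump k x) * q x)"
proof (rule rapidly_decreasingI)
  fix m
  \<comment> \<open>Outside the unit ball the bump vanishes, and inside it \<open>1 + norm x\<close>
    is at most 2.\<close>
  have "(1 + norm x) ^ m * cmod (of_real (bump k x) * q x) \<le> 2 ^ m * fact k" for x
  proof (cases "norm x \<le> 1")
    case True
    then show ?thesis
      using bump_le[of k x] bump_nonneg[of k x] assms[of x] by (auto simp: norm_mult intro!: mult_mono power_mono)
  next
    case False
    then show ?thesis
      using bump_le[of k x] bump_nonneg[of k x] by (auto simp: norm_mult)
  qed
  then show "\<exists>C. \<forall>x. (1 + norm x) ^ m * cmod (of_real (bump k x) * q x) \<le> C" by blast
qed

text \<open>The generators are all \<open>bump k\<close> times the same character. A derivative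
  falling on the character gives a constant; one falling on \<open>bump k\<close> gives, through the
  inner derivative of \<open>1 - x \<bullet> x\<close>, a coordinate times
  \<open>bump (k + 2)\<close> and \<open>bump (k + 1)\<close>.\<close>

lemma schwartz_modulated_bump:
  fixes \<xi> :: "real ^ 'n"
  shows "schwartz (\<lambda>x. of_real (bump 0 x) * cis (x \<bullet> \<xi>))"
proof -
  define B where "B = (range (\<lambda>k (x::real ^ 'n). complex_of_real (bump k x) * cis (x \<bullet> \<xi>)))"
  have pB: "polyspan B (\<lambda>x. complex_of_real (bump k x) * cis (x \<bullet> \<xi>))" for k
    by (intro polyspan.base) (auto simp: B_def)
  show ?thesis
  proof (rule polyspan_schwartz[OF _ pB])
    fix f assume "f \<in> B"
    then obtain k where f: "f = (\<lambda>x. complex_of_real (bump k x) * cis (x \<bullet> \<xi>))" by (auto simp: B_def)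
    define D where "D = (\<lambda>x v. of_real (bump k x) * (\<i> * of_real (v \<bullet> \<xi>) * cis (x \<bullet> \<xi>))
      + of_real ((bump (k + 2) x - real k * bump (k + 1) x) * (- 2 * (x \<bullet> v))) * cis (x \<bullet> \<xi>))"
    have "(f has_derivative D x) (at x)" for x
    proof -
      have 1: "((\<lambda>x. 1 - x \<bullet> x) has_derivative (\<lambda>v. - 2 * (x \<bullet> v))) (at x)"
        by (auto intro!: derivative_eq_intros simp: inner_commute)
      have 2: "(bump k has_derivative (\<lambda>v. (bump (k + 2) x - real k * bump (k + 1) x) * (- 2 * (x \<bullet> v)))) (at x)"
        using has_derivative_compose[OF 1 flat_has_real_derivative[unfolded has_field_derivative_def]]
        by (simp add: bump_def[abs_def])
      have 3: "((\<lambda>x. cis (x \<bullet> \<xi>)) has_derivative (\<lambda>v. \<i> * of_real (v \<bullet> \<xi>) * cis (x \<bullet> \<xi>))) (at x)"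
      proof -
        have "((\<lambda>x. x \<bullet> \<xi>) has_derivative (\<lambda>v. v \<bullet> \<xi>)) (at x)"
          by (auto intro!: derivative_eq_intros)
        moreover have "(cis has_derivative (\<lambda>t. \<i> * of_real t * cis (x \<bullet> \<xi>))) (at (x \<bullet> \<xi>))"
        proof -
          have "((\<lambda>z. exp (\<i> * z)) has_field_derivative (\<i> * cis (x \<bullet> \<xi>))) (at (of_real (x \<bullet> \<xi>)))"
            by (auto intro!: derivative_eq_intros simp: cis_conv_exp)
          from has_vector_derivative_real_field[OF this] show ?thesis
            by (simp add: cis_conv_exp[abs_def] has_vector_derivative_def scaleR_conv_of_real mult_ac)
        qed
        ultimately show ?thesis by (rule has_derivative_compose)
      qed
      show ?thesis unfolding f D_def by (rule has_derivative_mult[OF has_derivative_of_real[OF 2] 3])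
    qed
    moreover have "polyspan B (\<lambda>x. D x b)" if b: "b \<in> Basis" for b
    proof -
      have "polyspan B (\<lambda>x. (\<i> * of_real (b \<bullet> \<xi>)) * (complex_of_real (bump k x) * cis (x \<bullet> \<xi>))
        + (of_real (x \<bullet> b) * ((-2) * (complex_of_real (bump (k + 2) x) * cis (x \<bullet> \<xi>)))
           + of_real (x \<bullet> b) * ((2 * of_nat k) * (complex_of_real (bump (k + 1) x) * cis (x \<bullet> \<xi>)))))"
        by (intro polyspan.add polyspan.scale polyspan.coord b pB)
      moreover have "(\<lambda>x. D x b) = (\<lambda>x. (\<i> * of_real (b \<bullet> \<xi>)) * (complex_of_real (bump k x) * cis (x \<bullet> \<xi>))
        + (of_real (x \<bullet> b) * ((-2) * (complex_of_real (bump (k + 2) x) * cis (x \<bullet> \<xi>)))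
           + of_real (x \<bullet> b) * ((2 * of_nat k) * (complex_of_real (bump (k + 1) x) * cis (x \<bullet> \<xi>)))))"
        by (simp add: D_def fun_eq_iff algebra_simps)
      ultimately show ?thesis by simp
    qed
    moreover have "rapidly_decreasing f"
      unfolding f by (rule rapidly_decreasing_bump) simp
    ultimately show "rapidly_decreasing f \<and>
     (\<exists>D. (\<forall>x. (f has_derivative D x) (at x)) \<and> (\<forall>b\<in>Basis. polyspan B (\<lambda>x. D x b)))"
      by blast
  qed
qed

text \<open>At frequency 0 the transform of the bump is its positive integral, so by continuity it
  does not vanish near 0. Modulation only translates the transform, whence one radius for all
  centres.\<close>

lemma fourier_modulated_bump_nonzero:
  obtains r where "r > 0" "\<And>\<xi>0 \<xi>::real ^ 'n. dist \<xi> \<xi>0 < r \<Longrightarrow>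
     fourier (\<lambda>x. of_real (bump 0 x) * cis (x \<bullet> \<xi>0)) \<xi> \<noteq> 0"
proof -
  let ?b = "\<lambda>x::real ^ 'n. complex_of_real (bump 0 x)"
  have s: "schwartz ?b" using schwartz_modulated_bump[of 0] by simp
  have i: "integrable lborel ?b" by (rule schwartz_integrable[OF s])
  have ir: "integrable lborel (bump 0 :: real ^ 'n \<Rightarrow> real)"
    using i by (simp add: complex_of_real_integrable_eq)
  have "fint ?b 0 \<noteq> 0"
  proof
    assume "fint ?b 0 = 0"
    then have "(\<integral>x. bump 0 x \<partial>(lborel :: (real ^ 'n) measure)) = 0" by (simp add: fint_def)
    then have "AE x in (lborel :: (real ^ 'n) measure). bump 0 x = 0"
      by (subst (asm) integral_nonneg_eq_0_iff_AE[OF ir]) (auto simp: bump_nonneg)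
    \<comment> \<open>The bump is positive on the open unit ball, so its vanishing almost everywhere
      would make a nonempty open set null.\<close>
    then have "AE x in (lborel :: (real ^ 'n) measure). x \<notin> ball 0 1"
      by eventually_elim (use bump_pos in force)
    then have "ball (0::real ^ 'n) 1 \<in> null_sets lborel"
      by (subst AE_iff_null_sets) auto
    then have "negligible (ball (0::real ^ 'n) 1)"
      by (simp add: negligible_iff_null_sets null_sets_completionI)
    then show False using open_not_negligible[of "ball (0::real ^ 'n) 1"] by simp
  qed
  then have "\<forall>\<^sub>F z in nhds 0. fint ?b z \<noteq> 0"
    using continuous_fint[OF i] by (intro tendsto_imp_eventually_ne[of _ "fint ?b 0"])
      (auto simp: continuous_on_def tendsto_at_iff_tendsto_nhds)
  then obtain r where r: "r > 0" "\<And>z. dist z 0 < r \<Longrightarrow> fint ?b z \<noteq> 0"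
    by (auto simp: eventually_nhds_metric)
  show thesis
  proof (rule that[OF r(1)])
    fix \<xi>0 \<xi> :: "real ^ 'n" assume d: "dist \<xi> \<xi>0 < r"
    have "fourier (\<lambda>x. of_real (bump 0 x) * cis (x \<bullet> \<xi>0)) \<xi> = fint (\<lambda>x. of_real (bump 0 x) * cis (x \<bullet> \<xi>0)) (- \<xi>)"
      by (rule fourier_eq_fint[OF schwartz_borel[OF schwartz_modulated_bump]])
    also have "\<dots> = fint ?b (\<xi>0 - \<xi>)"
      unfolding fint_def by (intro Bochner_Integration.integral_cong refl)
        (simp add: mult.assoc cis_mult inner_diff_right inner_commute)
    finally show "fourier (\<lambda>x. of_real (bump 0 x) * cis (x \<bullet> \<xi>0)) \<xi> \<noteq> 0"
      using r(2)[of "\<xi>0 - \<xi>"] d by (simp add: dist_norm norm_minus_commute)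
  qed
qed

section \<open>Fourier multipliers on Banach function spaces\<close>

lemma completion_ex_borel_complex:
  fixes a :: "'a \<Rightarrow> complex"
  assumes a: "a \<in> borel_measurable (completion M)"
  obtains a' where "a' \<in> borel_measurable M" "AE x in M. a x = a' x"
proof -
  have "(\<lambda>x. Re (a x)) \<in> borel_measurable (completion M)" "(\<lambda>x. Im (a x)) \<in> borel_measurable (completion M)"
    using a by measurable
  then obtain p q where [measurable]: "p \<in> borel_measurable M" "q \<in> borel_measurable M"
    and "AE x in M. Re (a x) = p x" "AE x in M. Im (a x) = q x"
    using completion_ex_borel_measurable_real by metis
  then have "AE x in M. a x = Complex (p x) (q x)"
    by (auto simp: complex_eq_iff)
  moreover have "(\<lambda>x. Complex (p x) (q x)) \<in> borel_measurable M"
    unfolding Complex_eq by measurable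
  ultimately show thesis using that by blast
qed

text \<open>A Borel version is set to 0 wherever the essential bound fails, so that the bound holds
  at every point; the maximum with 0 covers the substituted value.\<close>

lemma Linf_borel_representative:
  assumes "a \<in> Linf"
  obtains a' C where "a' \<in> borel_measurable borel" "\<And>x. norm (a' x) \<le> C" "AE x in lebesgue. a x = a' x"
proof -
  obtain C where C: "AE x in lebesgue. cmod (a x) \<le> C" and am: "a \<in> borel_measurable lebesgue"
    using assms by (auto simp: Linf_def)
  obtain p where [measurable]: "p \<in> borel_measurable borel" and p: "AE x in lborel. a x = p x"
    using completion_ex_borel_complex[OF am] by auto
  define a' where "a' x = (if norm (p x) \<le> C then p x else 0)" for x
  show thesis
  proof
    show "a' \<in> borel_measurable borel" unfolding a'_def by measurable
    show "norm (a' x) \<le> max C 0" for x by (auto simp: a'_def)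
    show "AE x in lebesgue. a x = a' x"
      using C AE_completion[OF p] by eventually_elim (auto simp: a'_def)
  qed
qed

section \<open>Regularised Fourier inversion and injectivity\<close>

lemma inv_fourier_eq_fint:
  fixes g :: "real ^ 'n \<Rightarrow> complex"
  assumes "g \<in> borel_measurable borel"
  shows "inv_fourier g x = of_real (1 / (2 * pi) ^ CARD('n)) * fint g x"
proof -
  have "(2 * pi) powr (- real CARD('n)) = 1 / (2 * pi) ^ CARD('n)"
    by (simp add: powr_minus powr_realpow divide_inverse)
  moreover have "(\<integral>\<xi>. g \<xi> * cis (x \<bullet> \<xi>) \<partial>lebesgue) = fint g x"
    unfolding fint_def by (subst integral_completion) (use assms in auto)
  ultimately show ?thesis unfolding inv_fourier_def by simp
qed

text \<open>Decay of \<open>fourier u\<close> is the decay of \<open>fint u\<close> after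
  reflection, and a bounded symbol preserves moments. Every function to which the multiplier
  operator applies \<open>inv_fourier\<close> thus falls under the preceding theory.\<close>

lemma schwartz_fourier_all_moments:
  assumes u: "schwartz u" and a: "a \<in> borel_measurable borel" "\<And>x. norm (a x) \<le> C"
  shows "all_moments (\<lambda>\<xi>. a \<xi> * fourier u \<xi>)"
proof -
  have F: "fourier u = (\<lambda>\<xi>. fint u (- \<xi>))"
    using fourier_eq_fint[OF schwartz_borel[OF u]] by auto
  have m: "fourier u \<in> borel_measurable borel"
    unfolding F using fint_borel[OF schwartz_integrable[OF u]] by measurable
  have "rapidly_decreasing (fourier u)"
  proof (rule rapidly_decreasingI)
    fix m
    obtain K where "\<And>x. (1 + norm x) ^ m * cmod (fint u x) \<le> K"
      using rapidly_decreasingD[OF rapidly_decreasing_fint[OF u]] by metis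
    from this[of "- x" for x] show "\<exists>C. \<forall>x. (1 + norm x) ^ m * cmod (fourier u x) \<le> C"
      unfolding F by auto
  qed
  then have "all_moments (fourier u)"
    unfolding all_moments_def using rapidly_decreasing_integrable(1)[OF _ m] m by blast
  then show ?thesis
  proof (rule all_moments_mult[OF _ a(1)])
    fix y
    have "norm (a y) \<le> C" "0 \<le> C * norm y" using a(2)[of y] order_trans[OF norm_ge_zero a(2)[of y]] by auto
    then show "norm (a y) \<le> C * (1 + norm y)" by (simp add: distrib_left)
  qed
qed

text \<open>The constant in \<open>inv_fourier\<close> cancels the power of \<open>2 * pi\<close>
  from the Gaussian identity, leaving the Gauss-Weierstrass mean of \<open>g\<close>.\<close>

lemma fourier_inv_fourier_gaussian:
  fixes g :: "real ^ 'n \<Rightarrow> complex"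
  assumes g: "integrable lborel g" and e: "e > 0"
  shows "fourier (\<lambda>x. inv_fourier g x * of_real (exp (- (e * norm x)\<^sup>2 / 2))) t = (\<integral>z. gauss z *\<^sub>R g (t + e *\<^sub>R z) \<partial>lborel)"
proof -
  have m: "g \<in> borel_measurable borel" using g by auto
  have [measurable]: "fint g \<in> borel_measurable borel" by (rule fint_borel[OF g])
  let ?c = "complex_of_real (1 / (2 * pi) ^ CARD('n))"
  have "fourier (\<lambda>x. inv_fourier g x * of_real (exp (- (e * norm x)\<^sup>2 / 2))) t
    = (\<integral>x. ?c * ((of_real (exp (- (e * norm x)\<^sup>2 / 2)) * fint g x) * cis (- (x \<bullet> t))) \<partial>lborel)"
    unfolding fourier_def inv_fourier_eq_fint[OF m]
    by (subst integral_completion) (auto intro!: Bochner_Integration.integral_cong simp: mult_ac)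
  also have "\<dots> = ?c * (of_real ((2 * pi) ^ CARD('n)) * (\<integral>z. gauss z *\<^sub>R g (t + e *\<^sub>R z) \<partial>lborel))"
    using fourier_gaussian_times_inverse[OF g e, of t] unfolding fint_def by simp
  finally show ?thesis by simp
qed

lemma tendsto_L1_fourier_inv_fourier_gaussian:
  fixes g :: "real ^ 'n \<Rightarrow> complex"
  assumes g: "integrable lborel g"
  defines "f \<equiv> (\<lambda>n. fourier (\<lambda>x. inv_fourier g x * of_real (exp (- (1 / real (Suc n) * norm x)\<^sup>2 / 2))))"
  shows "(\<lambda>n. \<integral>y. norm (f n y - g y) \<partial>lborel) \<longlonglongrightarrow> 0" "integrable lborel (f n)"
proof -
  have f: "f n = (\<lambda>y. \<integral>z. gauss z *\<^sub>R g (y + (1 / real (Suc n)) *\<^sub>R z) \<partial>lborel)" for n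
    unfolding f_def by (rule ext, rule fourier_inv_fourier_gaussian[OF g]) simp
  have e: "(\<lambda>n. 1 / real (Suc n)) \<longlonglongrightarrow> 0"
    using LIMSEQ_inverse_real_of_nat by (simp add: inverse_eq_divide)
  show "(\<lambda>n. \<integral>y. norm (f n y - g y) \<partial>lborel) \<longlonglongrightarrow> 0"
    unfolding f by (rule tendsto_L1_approximate_identity(1)[OF g integrable_gauss gauss_nonneg integral_gauss e])
  show "integrable lborel (f n)"
    unfolding f by (rule tendsto_L1_approximate_identity(2)[OF g integrable_gauss gauss_nonneg integral_gauss e])
qed

text \<open>If the inverse transform vanishes almost everywhere, so do all its Gaussian
  regularisations, and their Fourier transforms are 0 everywhere. The L1 errors then form the
  constant sequence \<open>\<integral>y. norm (g y) \<partial>lborel\<close>, which must be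
  0.\<close>

lemma inv_fourier_eq_0_AE_imp:
  fixes g :: "real ^ 'n \<Rightarrow> complex"
  assumes g: "integrable lborel g" and z: "AE x in lebesgue. inv_fourier g x = 0"
  shows "AE y in lborel. g y = 0"
proof -
  have "fourier (\<lambda>x. inv_fourier g x * of_real (exp (- (e * norm x)\<^sup>2 / 2))) y = 0" for e y
    unfolding fourier_def using z by (intro integral_eq_zero_AE) auto
  then have "(\<integral>y. norm (g y) \<partial>lborel) = 0"
    using tendsto_L1_fourier_inv_fourier_gaussian(1)[OF g] by (simp only: diff_0 norm_minus_cancel LIMSEQ_const_iff)
  then show ?thesis
    by (subst (asm) integral_nonneg_eq_0_iff_AE) (use g in auto)
qed

section \<open>Consequences of the axioms of a Banach function norm\<close>

lemma banach_function_norm_0: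
  assumes "banach_function_norm \<rho>" shows "\<rho> (\<lambda>x. 0) = 0"
  using assms by (auto simp: banach_function_norm_def nonneg_meas_def)

lemma banach_function_norm_eq_0D:
  assumes "banach_function_norm \<rho>" "f \<in> borel_measurable lebesgue" "\<rho> f = 0"
  shows "AE x in lebesgue. f x = 0"
  using assms by (auto simp: banach_function_norm_def nonneg_meas_def)

lemma banach_function_norm_scale:
  assumes "banach_function_norm \<rho>" "f \<in> borel_measurable lebesgue" "c \<ge> 0"
  shows "\<rho> (\<lambda>x. ennreal c * f x) = ennreal c * \<rho> f"
  using assms by (auto simp: banach_function_norm_def nonneg_meas_def)

lemma banach_function_norm_triangle:
  assumes "banach_function_norm \<rho>" "f \<in> borel_measurable lebesgue" "g \<in> borel_measurable lebesgue"
  shows "\<rho> (\<lambda>x. f x + g x) \<le> \<rho> f + \<rho> g"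
  using assms by (auto simp: banach_function_norm_def nonneg_meas_def)

lemma banach_function_norm_mono:
  assumes "banach_function_norm \<rho>" "f \<in> borel_measurable lebesgue" "g \<in> borel_measurable lebesgue"
    and "\<And>x. f x \<le> g x"
  shows "\<rho> f \<le> \<rho> g"
  using assms by (simp add: banach_function_norm_def nonneg_meas_def)

lemma banach_function_norm_indicator:
  assumes "banach_function_norm \<rho>" "E \<in> sets lebesgue" "emeasure lebesgue E < \<infinity>"
  shows "\<rho> (indicator E) < \<infinity>"
  using assms by (auto simp: banach_function_norm_def)

text \<open>Axiom (A3) speaks of increasing sequences, so it is applied to the tail infima
  \<open>G j\<close>. They increase to the lower limit, which is \<open>f\<close>, and by (A2) their
  norms inherit the bound.\<close>

lemma banach_function_norm_Fatou:
  assumes \<rho>: "banach_function_norm \<rho>"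
    and F: "\<And>j. F j \<in> borel_measurable lebesgue" and lim: "\<And>x. (\<lambda>j::nat. F j x) \<longlonglongrightarrow> f x"
    and le: "\<And>j. \<rho> (F j) \<le> M"
  shows "\<rho> f \<le> M"
proof -
  define G where "G j x = (INF i\<in>{j..}. F i x)" for j x
  have Gm: "G j \<in> borel_measurable lebesgue" for j
    unfolding G_def[abs_def] using F by (intro borel_measurable_INF) auto
  have fm: "f \<in> borel_measurable lebesgue"
    by (rule borel_measurable_LIMSEQ_order[OF lim F])
  have inc: "incseq (\<lambda>j. G j x)" for x
    unfolding G_def by (intro incseq_SucI INF_superset_mono) auto
  have Glim: "(\<lambda>j. G j x) \<longlonglongrightarrow> f x" for x
  proof -
    have "(SUP j. G j x) = liminf (\<lambda>j. F j x)" unfolding G_def liminf_SUP_INF ..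
    also have "\<dots> = f x" by (rule lim_imp_Liminf[OF _ lim]) simp
    finally show ?thesis using LIMSEQ_SUP[OF inc, of x] by simp
  qed
  have "(\<lambda>j. \<rho> (G j)) \<longlonglongrightarrow> \<rho> f"
  proof -
    have "\<forall>F f. (\<forall>j. F j \<in> nonneg_meas) \<longrightarrow> f \<in> nonneg_meas \<longrightarrow>
        (AE x in lebesgue. incseq (\<lambda>j. F j x) \<and> (\<lambda>j. F j x) \<longlonglongrightarrow> f x) \<longrightarrow>
        incseq (\<lambda>j. \<rho> (F j)) \<and> (\<lambda>j. \<rho> (F j)) \<longlonglongrightarrow> \<rho> f"
      using \<rho> unfolding banach_function_norm_def by (elim conjE)
    from this[rule_format, of G f] show ?thesis
      using Gm fm inc Glim by (simp add: nonneg_meas_def)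
  qed
  moreover have "\<rho> (G j) \<le> M" for j
  proof -
    have "\<rho> (G j) \<le> \<rho> (F j)"
      by (rule banach_function_norm_mono[OF \<rho> Gm F]) (auto simp: G_def intro: INF_lower)
    then show ?thesis using le order_trans by blast
  qed
  ultimately show ?thesis by (intro LIMSEQ_le_const2) auto
qed

section \<open>The multiplier operator and its extended norm\<close>

abbreviation rho_mod :: "((real ^ 'n \<Rightarrow> ennreal) \<Rightarrow> ennreal) \<Rightarrow> (real ^ 'n \<Rightarrow> complex) \<Rightarrow> ennreal" where
  "rho_mod \<rho> f \<equiv> \<rho> (\<lambda>x. ennreal (cmod (f x)))"

abbreviation mult_op :: "(real ^ 'n \<Rightarrow> complex) \<Rightarrow> (real ^ 'n \<Rightarrow> complex) \<Rightarrow> (real ^ 'n \<Rightarrow> complex)" where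
  "mult_op a u \<equiv> inv_fourier (\<lambda>\<xi>. a \<xi> * fourier u \<xi>)"

lemma mult_norm_enn_bound:
  assumes \<rho>: "banach_function_norm \<rho>" and u: "schwartz u" "u \<in> bfs \<rho>" and fin: "mult_norm_enn \<rho> a < \<infinity>"
  shows "rho_mod \<rho> (mult_op a u) \<le> mult_norm_enn \<rho> a * rho_mod \<rho> u"
proof (cases "u = (\<lambda>x. 0)")
  case True
  then have "mult_op a u = (\<lambda>x. 0)" by (simp add: inv_fourier_def fourier_def fun_eq_iff)
  then show ?thesis using banach_function_norm_0[OF \<rho>] by simp
next
  case False
  have ufin: "rho_mod \<rho> u < \<infinity>" using u by (simp add: bfs_def)
  have le: "rho_mod \<rho> (mult_op a u) / rho_mod \<rho> u \<le> mult_norm_enn \<rho> a"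
    unfolding mult_norm_enn_def using u False by (intro SUP_upper) auto
  show ?thesis
  proof (cases "rho_mod \<rho> u = 0")
    case True
    then have "rho_mod \<rho> (mult_op a u) = 0"
      \<comment> \<open>In \<open>ennreal\<close> a nonzero value divided by 0 is infinite, so
        finiteness of the multiplier norm forces the numerator to vanish.\<close>
      using le fin by (cases "rho_mod \<rho> (mult_op a u) = 0") (auto simp: ennreal_divide_zero top_unique)
    then show ?thesis by simp
  next
    case False
    have "rho_mod \<rho> (mult_op a u) = rho_mod \<rho> (mult_op a u) / rho_mod \<rho> u * rho_mod \<rho> u"
      using False ufin by (simp add: ennreal_divide_times ennreal_mult_divide_eq)
    also have "\<dots> \<le> mult_norm_enn \<rho> a * rho_mod \<rho> u" by (intro mult_right_mono le) simp
    finally show ?thesis .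
  qed
qed

lemma mult_norm_enn_le:
  assumes "\<And>u. schwartz u \<Longrightarrow> u \<in> bfs \<rho> \<Longrightarrow> rho_mod \<rho> (mult_op a u) \<le> M * rho_mod \<rho> u"
  shows "mult_norm_enn \<rho> a \<le> M"
  unfolding mult_norm_enn_def
proof (rule SUP_least)
  fix u assume "u \<in> {u. schwartz u \<and> u \<in> bfs \<rho> \<and> u \<noteq> (\<lambda>x. 0)}"
  then have u: "schwartz u" "u \<in> bfs \<rho>" by auto
  have "rho_mod \<rho> (mult_op a u) / rho_mod \<rho> u \<le> M * rho_mod \<rho> u / rho_mod \<rho> u"
    using assms[OF u] by (rule divide_right_mono_ennreal)
  also have "\<dots> \<le> M"
  proof (cases "rho_mod \<rho> u = 0")
    case False
    moreover have "rho_mod \<rho> u \<noteq> top" using u by (simp add: bfs_def less_top)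
    ultimately show ?thesis by (simp add: ennreal_mult_divide_eq)
  qed simp
  finally show "rho_mod \<rho> (mult_op a u) / rho_mod \<rho> u \<le> M" .
qed

text \<open>Symbols that agree almost everywhere give the same transform at every point, not just
  almost everywhere. This permits the passage to bounded Borel representatives.\<close>

lemma mult_norm_enn_cong_AE:
  fixes a a' :: "real ^ 'n \<Rightarrow> complex"
  assumes "AE x in lebesgue. a x = a' x" "a \<in> borel_measurable lebesgue" "a' \<in> borel_measurable lebesgue"
  shows "mult_norm_enn \<rho> a = mult_norm_enn \<rho> a'"
proof -
  have "mult_op a u = mult_op a' u" if "schwartz u" for u
  proof
    fix x :: "real ^ 'n"
    have [measurable]: "a \<in> borel_measurable lebesgue" "a' \<in> borel_measurable lebesgue" by fact+
    have "(\<lambda>\<xi>. 1 * fourier u \<xi>) \<in> borel_measurable borel"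
      using schwartz_fourier_all_moments[OF that, of "\<lambda>_. 1" 1] by (simp add: all_moments_def)
    then have [measurable]: "fourier u \<in> borel_measurable lebesgue" by (simp add: measurable_completion)
    have [measurable]: "(\<lambda>\<xi>. cis (x \<bullet> \<xi>)) \<in> borel_measurable lebesgue"
      by (intro measurable_completion) simp
    show "mult_op a u x = mult_op a' u x"
      unfolding inv_fourier_def using assms(1) by (intro arg_cong2[where f="(*)"] refl integral_cong_AE) auto
  qed
  then show ?thesis unfolding mult_norm_enn_def by (intro SUP_cong) auto
qed

lemma mult_op_eq_fint:
  fixes x :: "real ^ 'n"
  assumes u: "schwartz u" and a: "a \<in> borel_measurable borel" "\<And>x. norm (a x) \<le> C"
  shows "mult_op a u x = of_real (1 / (2 * pi) ^ CARD('n)) * fint (\<lambda>\<xi>. a \<xi> * fourier u \<xi>) x"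
  using schwartz_fourier_all_moments[OF u a] by (intro inv_fourier_eq_fint) (simp add: all_moments_def)

lemma mult_op_borel:
  fixes a :: "real ^ 'n \<Rightarrow> complex"
  assumes "schwartz u" "a \<in> borel_measurable borel" "\<And>x. norm (a x) \<le> C"
  shows "mult_op a u \<in> borel_measurable borel"
proof -
  have [measurable]: "fint (\<lambda>\<xi>. a \<xi> * fourier u \<xi>) \<in> borel_measurable borel"
    by (intro fint_borel all_moments_integrable schwartz_fourier_all_moments[OF assms])
  show ?thesis unfolding mult_op_eq_fint[OF assms, abs_def] by measurable
qed

lemma cmod_mult_op_lebesgue:
  fixes a :: "real ^ 'n \<Rightarrow> complex"
  assumes "schwartz u" "a \<in> borel_measurable borel" "\<And>x. norm (a x) \<le> C"
  shows "(\<lambda>x. ennreal (cmod (mult_op a u x))) \<in> borel_measurable lebesgue"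
proof -
  have [measurable]: "mult_op a u \<in> borel_measurable borel" by (rule mult_op_borel[OF assms])
  show ?thesis by (intro measurable_completion) simp
qed

lemma mult_norm_enn_add:
  fixes a b :: "real ^ 'n \<Rightarrow> complex"
  assumes \<rho>: "banach_function_norm \<rho>"
    and a: "a \<in> borel_measurable borel" "\<And>x. norm (a x) \<le> A"
    and b: "b \<in> borel_measurable borel" "\<And>x. norm (b x) \<le> B"
    and fin: "mult_norm_enn \<rho> a < \<infinity>" "mult_norm_enn \<rho> b < \<infinity>"
  shows "mult_norm_enn \<rho> (\<lambda>\<xi>. a \<xi> + b \<xi>) \<le> mult_norm_enn \<rho> a + mult_norm_enn \<rho> b"
proof (rule mult_norm_enn_le)
  fix u assume u: "schwartz u" "u \<in> bfs \<rho>"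
  have ab: "(\<lambda>\<xi>. a \<xi> + b \<xi>) \<in> borel_measurable borel" "norm (a x + b x) \<le> A + B" for x
    using a b by (auto intro!: order_trans[OF norm_triangle_ineq add_mono])
  have ia: "integrable lborel (\<lambda>\<xi>. a \<xi> * fourier u \<xi>)" and ib: "integrable lborel (\<lambda>\<xi>. b \<xi> * fourier u \<xi>)"
    using schwartz_fourier_all_moments[OF u(1)] a b by (blast intro: all_moments_integrable)+
  have eq: "mult_op (\<lambda>\<xi>. a \<xi> + b \<xi>) u x = mult_op a u x + mult_op b u x" for x
    unfolding mult_op_eq_fint[OF u(1) a] mult_op_eq_fint[OF u(1) b] mult_op_eq_fint[OF u(1) ab] fint_def
    using Bochner_Integration.integral_add[OF integrable_times_cis[OF ia, of x] integrable_times_cis[OF ib, of x]]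
    by (simp add: distrib_left distrib_right)
  have "rho_mod \<rho> (mult_op (\<lambda>\<xi>. a \<xi> + b \<xi>) u) \<le> \<rho> (\<lambda>x. ennreal (cmod (mult_op a u x)) + ennreal (cmod (mult_op b u x)))"
    using cmod_mult_op_lebesgue[OF u(1) a] cmod_mult_op_lebesgue[OF u(1) b] cmod_mult_op_lebesgue[OF u(1) ab]
    by (intro banach_function_norm_mono[OF \<rho>])
      (auto simp: eq norm_triangle_ineq simp flip: ennreal_plus intro!: ennreal_leI)
  also have "\<dots> \<le> rho_mod \<rho> (mult_op a u) + rho_mod \<rho> (mult_op b u)"
    by (intro banach_function_norm_triangle[OF \<rho>] cmod_mult_op_lebesgue[OF u(1) a] cmod_mult_op_lebesgue[OF u(1) b])
  also have "\<dots> \<le> mult_norm_enn \<rho> a * rho_mod \<rho> u + mult_norm_enn \<rho> b * rho_mod \<rho> u"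
    by (intro add_mono mult_norm_enn_bound[OF \<rho> u] fin)
  finally show "rho_mod \<rho> (mult_op (\<lambda>\<xi>. a \<xi> + b \<xi>) u) \<le> (mult_norm_enn \<rho> a + mult_norm_enn \<rho> b) * rho_mod \<rho> u"
    by (simp add: distrib_right)
qed

text \<open>The constant passes through the integral, the norm and the supremum. The case
  \<open>c = 0\<close> is included and later yields norm 0 for symbols vanishing almost
  everywhere.\<close>

lemma mult_norm_enn_scale:
  fixes a :: "real ^ 'n \<Rightarrow> complex"
  assumes \<rho>: "banach_function_norm \<rho>"
    and a: "a \<in> borel_measurable borel" "\<And>x. norm (a x) \<le> A"
  shows "mult_norm_enn \<rho> (\<lambda>\<xi>. c * a \<xi>) = ennreal (cmod c) * mult_norm_enn \<rho> a"
proof -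
  have "rho_mod \<rho> (mult_op (\<lambda>\<xi>. c * a \<xi>) u) = ennreal (cmod c) * rho_mod \<rho> (mult_op a u)" if u: "schwartz u" for u
  proof -
    have "mult_op (\<lambda>\<xi>. c * a \<xi>) u x = c * mult_op a u x" for x
      unfolding inv_fourier_def by (simp add: mult.assoc)
    then show ?thesis
      using banach_function_norm_scale[OF \<rho> cmod_mult_op_lebesgue[OF u a], of "cmod c"]
      by (simp add: norm_mult ennreal_mult)
  qed
  then show ?thesis
    unfolding mult_norm_enn_def SUP_mult_left_ennreal
    by (intro SUP_cong refl) (simp add: ennreal_times_divide)
qed

lemma mult_norm_enn_mult:
  fixes a b :: "real ^ 'n \<Rightarrow> complex"
  assumes \<rho>: "banach_function_norm \<rho>"
    and a: "a \<in> borel_measurable borel" "\<And>x. norm (a x) \<le> A"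
    and b: "b \<in> borel_measurable borel" "\<And>x. norm (b x) \<le> B"
    and fin: "mult_norm_enn \<rho> a < \<infinity>" "mult_norm_enn \<rho> b < \<infinity>"
  shows "mult_norm_enn \<rho> (\<lambda>\<xi>. a \<xi> * b \<xi>) \<le> mult_norm_enn \<rho> a * mult_norm_enn \<rho> b"
proof (rule mult_norm_enn_le)
  fix u assume u: "schwartz u" "u \<in> bfs \<rho>"
  define g where "g = (\<lambda>\<xi>. b \<xi> * fourier u \<xi>)"
  define v where "v = inv_fourier g"
  define e where "e n = 1 / real (Suc n)" for n
  define vn where "vn n = (\<lambda>x. v x * of_real (exp (- (e n * norm x)\<^sup>2 / 2)))" for n
  let ?c = "complex_of_real (1 / (2 * pi) ^ CARD('n))"
  have gm: "all_moments g" unfolding g_def by (rule schwartz_fourier_all_moments[OF u(1) b])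
  have gi: "integrable lborel g" by (rule all_moments_integrable[OF gm])
  have vm: "(\<lambda>x. ennreal (cmod (v x))) \<in> borel_measurable lebesgue"
    unfolding v_def g_def by (rule cmod_mult_op_lebesgue[OF u(1) b])
  have vle: "rho_mod \<rho> v \<le> mult_norm_enn \<rho> b * rho_mod \<rho> u"
    unfolding v_def g_def by (rule mult_norm_enn_bound[OF \<rho> u fin(2)])
  have ufin: "rho_mod \<rho> u < \<infinity>" using u by (simp add: bfs_def)
  have vn_schwartz: "schwartz (vn n)" for n
  proof -
    \<comment> \<open>Moving the normalising constant into the integrand presents \<open>v\<close>
      itself as a \<open>fint\<close>, the form covered by
      \<open>schwartz_fint_gaussian\<close>.\<close>
    have "all_moments (\<lambda>\<xi>. ?c * g \<xi>)"
      by (rule all_moments_mult[OF gm, where C="norm ?c"]) (auto simp: divide_right_mono)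
    from schwartz_fint_gaussian[OF this, of "e n"]
    have "schwartz (\<lambda>x. fint (\<lambda>\<xi>. ?c * g \<xi>) x * of_real (exp (- (e n * norm x)\<^sup>2 / 2)))"
      by (simp add: e_def)
    moreover have "fint (\<lambda>\<xi>. ?c * g \<xi>) x = v x" for x
      unfolding v_def using gi by (subst inv_fourier_eq_fint) (auto simp: fint_def mult.assoc simp del: of_real_divide)
    ultimately show ?thesis by (simp add: vn_def)
  qed
  have vn_le: "cmod (vn n x) \<le> cmod (v x)" for n x
    by (simp add: vn_def norm_mult mult_left_le)
  have vn_rho: "rho_mod \<rho> (vn n) \<le> rho_mod \<rho> v" for n
  proof (rule banach_function_norm_mono[OF \<rho> _ vm])
    have [measurable]: "vn n \<in> borel_measurable borel" by (rule schwartz_borel[OF vn_schwartz])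
    show "(\<lambda>x. ennreal (cmod (vn n x))) \<in> borel_measurable lebesgue"
      by (intro measurable_completion) simp
  qed (simp add: vn_le ennreal_leI)
  have vn_bfs: "vn n \<in> bfs \<rho>" for n
  proof -
    \<comment> \<open>The multiplier bound for \<open>b\<close> makes the norm of \<open>v\<close>
      finite, and this is inherited by its pointwise smaller regularisations.\<close>
    have "mult_norm_enn \<rho> b * rho_mod \<rho> u < \<infinity>"
      using fin(2) ufin by (simp add: ennreal_mult_less_top)
    then show ?thesis
      using order_trans[OF vn_rho[of n] vle] schwartz_borel[OF vn_schwartz, of n]
      by (auto simp: bfs_def intro: measurable_completion order_le_less_trans)
  qed
  have ab: "(\<lambda>\<xi>. a \<xi> * b \<xi>) \<in> borel_measurable borel" "norm (a x * b x) \<le> A * B" for x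
    using a b order_trans[OF norm_ge_zero a(2)[of x]] by (auto simp: norm_mult intro!: mult_mono)
  have A0: "0 \<le> A" using order_trans[OF norm_ge_zero a(2)] .
  have lim: "(\<lambda>n. mult_op a (vn n) x) \<longlonglongrightarrow> mult_op (\<lambda>\<xi>. a \<xi> * b \<xi>) u x" for x
  proof -
    have L: "(\<lambda>n. \<integral>y. norm (fourier (vn n) y - g y) \<partial>lborel) \<longlonglongrightarrow> 0"
      and Li: "integrable lborel (fourier (vn n))" for n
      using tendsto_L1_fourier_inv_fourier_gaussian[OF gi] by (simp_all add: vn_def v_def e_def)
    \<comment> \<open>Boundedness of \<open>a\<close> keeps the L1 convergence, and a transform is
      bounded at each point by the L1 norm; convergence therefore holds for every
      \<open>x\<close>.\<close>
    have "(\<lambda>n. fint (\<lambda>\<xi>. a \<xi> * fourier (vn n) \<xi>) x - fint (\<lambda>\<xi>. a \<xi> * g \<xi>) x) \<longlonglongrightarrow> 0"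
    proof (rule Lim_null_comparison)
      show "\<forall>\<^sub>F n in sequentially. norm (fint (\<lambda>\<xi>. a \<xi> * fourier (vn n) \<xi>) x - fint (\<lambda>\<xi>. a \<xi> * g \<xi>) x)
          \<le> A * (\<integral>y. norm (fourier (vn n) y - g y) \<partial>lborel)"
      proof (intro always_eventually allI)
        fix n
        have bi: "integrable lborel (\<lambda>\<xi>. a \<xi> * f \<xi>)" if f: "integrable lborel f" for f :: "real ^ 'n \<Rightarrow> complex"
        proof (rule Bochner_Integration.integrable_bound)
          show "integrable lborel (\<lambda>\<xi>. A *\<^sub>R f \<xi>)" using f by simp
          show "(\<lambda>\<xi>. a \<xi> * f \<xi>) \<in> borel_measurable lborel" using a f by auto
        qed (use a A0 in \<open>auto simp: norm_mult intro!: mult_right_mono\<close>)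
        have di: "integrable lborel (\<lambda>\<xi>. fourier (vn n) \<xi> - g \<xi>)"
          by (intro Bochner_Integration.integrable_diff Li gi)
        have "fint (\<lambda>\<xi>. a \<xi> * fourier (vn n) \<xi>) x - fint (\<lambda>\<xi>. a \<xi> * g \<xi>) x
            = fint (\<lambda>\<xi>. a \<xi> * (fourier (vn n) \<xi> - g \<xi>)) x"
          unfolding fint_def
          using Bochner_Integration.integral_diff[OF integrable_times_cis[OF bi[OF Li[of n]], of x] integrable_times_cis[OF bi[OF gi], of x]]
          by (simp add: left_diff_distrib right_diff_distrib)
        then have "norm (fint (\<lambda>\<xi>. a \<xi> * fourier (vn n) \<xi>) x - fint (\<lambda>\<xi>. a \<xi> * g \<xi>) x)
            \<le> (\<integral>\<xi>. norm (a \<xi> * (fourier (vn n) \<xi> - g \<xi>)) \<partial>lborel)"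
          using norm_fint_le by simp
        also have "\<dots> \<le> (\<integral>\<xi>. A * norm (fourier (vn n) \<xi> - g \<xi>) \<partial>lborel)"
          using a A0 by (intro integral_mono integrable_norm integrable_mult_right bi di)
            (auto simp: norm_mult intro!: mult_right_mono)
        finally show "norm (fint (\<lambda>\<xi>. a \<xi> * fourier (vn n) \<xi>) x - fint (\<lambda>\<xi>. a \<xi> * g \<xi>) x)
          \<le> A * (\<integral>y. norm (fourier (vn n) y - g y) \<partial>lborel)" by simp
      qed
      show "(\<lambda>n. A * (\<integral>y. norm (fourier (vn n) y - g y) \<partial>lborel)) \<longlonglongrightarrow> 0"
        using tendsto_mult_right_zero[OF L] .
    qed
    then have "(\<lambda>n. ?c * fint (\<lambda>\<xi>. a \<xi> * fourier (vn n) \<xi>) x) \<longlonglongrightarrow> ?c * fint (\<lambda>\<xi>. a \<xi> * g \<xi>) x"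
      by (intro tendsto_mult tendsto_const) (simp only: LIM_zero_iff)
    then show ?thesis
      unfolding mult_op_eq_fint[OF vn_schwartz a] mult_op_eq_fint[OF u(1) ab] by (simp only: g_def mult.assoc)
  qed
  have "rho_mod \<rho> (mult_op (\<lambda>\<xi>. a \<xi> * b \<xi>) u) \<le> mult_norm_enn \<rho> a * rho_mod \<rho> v"
  proof (rule banach_function_norm_Fatou[OF \<rho>])
    show "(\<lambda>x. ennreal (cmod (mult_op a (vn n) x))) \<in> borel_measurable lebesgue" for n
      by (rule cmod_mult_op_lebesgue[OF vn_schwartz a])
    show "(\<lambda>n. ennreal (cmod (mult_op a (vn n) x))) \<longlonglongrightarrow> ennreal (cmod (mult_op (\<lambda>\<xi>. a \<xi> * b \<xi>) u x))" for x
      by (intro tendsto_ennrealI tendsto_norm lim)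
    \<comment> \<open>The bound does not depend on \<open>n\<close>, because no regularisation has
      larger norm than \<open>v\<close>; this is what the Fatou argument needs.\<close>
    show "rho_mod \<rho> (mult_op a (vn n)) \<le> mult_norm_enn \<rho> a * rho_mod \<rho> v" for n
      by (rule order_trans[OF mult_norm_enn_bound[OF \<rho> vn_schwartz vn_bfs fin(1)] mult_left_mono[OF vn_rho]]) simp
  qed
  also have "\<dots> \<le> mult_norm_enn \<rho> a * (mult_norm_enn \<rho> b * rho_mod \<rho> u)"
    by (intro mult_left_mono vle) simp
  finally show "rho_mod \<rho> (mult_op (\<lambda>\<xi>. a \<xi> * b \<xi>) u) \<le> (mult_norm_enn \<rho> a * mult_norm_enn \<rho> b) * rho_mod \<rho> u"
    by (simp add: mult.assoc)
qed

section \<open>Definiteness of the multiplier norm\<close>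

lemma modulated_bump_in_bfs:
  assumes \<rho>: "banach_function_norm \<rho>"
  shows "(\<lambda>x::real ^ 'n. complex_of_real (bump 0 x) * cis (x \<bullet> \<xi>)) \<in> bfs \<rho>" (is "?u \<in> _")
proof -
  have [measurable]: "?u \<in> borel_measurable borel" by (rule schwartz_borel[OF schwartz_modulated_bump])
  have E: "cball (0::real ^ 'n) 1 \<in> sets lebesgue" by auto
  have "rho_mod \<rho> ?u \<le> \<rho> (indicator (cball 0 1))"
  proof (rule banach_function_norm_mono[OF \<rho>])
    show "(\<lambda>x. ennreal (cmod (?u x))) \<in> borel_measurable lebesgue" by (intro measurable_completion) simp
    show "(indicator (cball 0 1) :: real ^ 'n \<Rightarrow> ennreal) \<in> borel_measurable lebesgue"
      by (rule borel_measurable_indicator[OF E])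
    show "ennreal (cmod (?u x)) \<le> indicator (cball 0 1) x" for x
      using bump_le[of 0 x] bump_nonneg[of 0 x]
      by (auto simp: norm_mult indicator_def ennreal_le_1 split: if_splits)
  qed
  also have "\<dots> < \<infinity>"
    by (rule banach_function_norm_indicator[OF \<rho> E]) (use emeasure_lborel_cball_finite[of 0 1] in simp)
  finally show ?thesis by (simp add: bfs_def measurable_completion)
qed

text \<open>Each test function yields \<open>a\<close> times its transform equal to 0 outside a null
  set depending on the centre. A countable dense set of centres gives one common null set, and since
  the radius of non-vanishing is uniform, every frequency is close enough to some centre.\<close>

lemma mult_norm_enn_eq_0_imp:
  fixes a :: "real ^ 'n \<Rightarrow> complex"
  assumes \<rho>: "banach_function_norm \<rho>"
    and a: "a \<in> borel_measurable borel" "\<And>x. norm (a x) \<le> A"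
    and 0: "mult_norm_enn \<rho> a = 0"
  shows "AE x in lborel. a x = 0"
proof -
  let ?u = "\<lambda>\<xi>0 x::real ^ 'n. complex_of_real (bump 0 x) * cis (x \<bullet> \<xi>0)"
  have z: "AE \<xi> in lborel. a \<xi> * fourier (?u \<xi>0) \<xi> = 0" for \<xi>0
  proof -
    note s = schwartz_modulated_bump[of \<xi>0]
    have "rho_mod \<rho> (mult_op a (?u \<xi>0)) = 0"
      using mult_norm_enn_bound[OF \<rho> s modulated_bump_in_bfs[OF \<rho>], of a] 0 by simp
    then have "AE x in lebesgue. ennreal (cmod (mult_op a (?u \<xi>0) x)) = 0"
      by (rule banach_function_norm_eq_0D[OF \<rho> cmod_mult_op_lebesgue[OF s a]])
    then have "AE x in lebesgue. mult_op a (?u \<xi>0) x = 0" by eventually_elim simp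
    then show ?thesis
      by (intro inv_fourier_eq_0_AE_imp all_moments_integrable schwartz_fourier_all_moments[OF s a])
  qed
  obtain r where r: "r > 0" "\<And>\<xi>0 \<xi>::real ^ 'n. dist \<xi> \<xi>0 < r \<Longrightarrow> fourier (?u \<xi>0) \<xi> \<noteq> 0"
    using fourier_modulated_bump_nonzero by blast
  obtain D :: "(real ^ 'n) set" where D: "countable D" "\<And>X. open X \<Longrightarrow> X \<noteq> {} \<Longrightarrow> \<exists>d\<in>D. d \<in> X"
    using countable_dense_setE by blast
  have "AE \<xi> in lborel. \<forall>\<xi>0\<in>D. a \<xi> * fourier (?u \<xi>0) \<xi> = 0"
    using D(1) z by (subst AE_ball_countable) auto
  then show ?thesis
  proof eventually_elim
    case (elim \<xi>)
    obtain d where "d \<in> D" "d \<in> ball \<xi> r" using D(2)[of "ball \<xi> r"] r(1) by auto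
    then show ?case using elim r(2)[of \<xi> d] by auto
  qed
qed

theorem theorem6p4:
  fixes \<rho> :: "(real ^ 'n \<Rightarrow> ennreal) \<Rightarrow> ennreal"
  assumes "banach_function_norm \<rho>"
  shows "\<forall>a\<in>multipliers \<rho> \<inter> Linf. \<forall>b\<in>multipliers \<rho> \<inter> Linf. \<forall>c::complex.
           (\<lambda>\<xi>. a \<xi> + b \<xi>) \<in> multipliers \<rho> \<inter> Linf \<and>
           (\<lambda>\<xi>. c * a \<xi>) \<in> multipliers \<rho> \<inter> Linf \<and>
           (\<lambda>\<xi>. a \<xi> * b \<xi>) \<in> multipliers \<rho> \<inter> Linf \<and>
           mult_norm \<rho> (\<lambda>\<xi>. a \<xi> + b \<xi>) \<le> mult_norm \<rho> a + mult_norm \<rho> b \<and>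
           mult_norm \<rho> (\<lambda>\<xi>. c * a \<xi>) = cmod c * mult_norm \<rho> a \<and>
           (mult_norm \<rho> a = 0 \<longleftrightarrow> (AE \<xi> in lebesgue. a \<xi> = 0)) \<and>
           mult_norm \<rho> (\<lambda>\<xi>. a \<xi> * b \<xi>) \<le> mult_norm \<rho> a * mult_norm \<rho> b"
proof (intro ballI allI)
  fix a b c assume "a \<in> multipliers \<rho> \<inter> Linf" "b \<in> multipliers \<rho> \<inter> Linf"
  then have aL: "a \<in> Linf" and bL: "b \<in> Linf"
    and fin: "mult_norm_enn \<rho> a < \<infinity>" "mult_norm_enn \<rho> b < \<infinity>"
    by (auto simp: multipliers_def)
  note \<rho> = assms
  have [measurable]: "a \<in> borel_measurable lebesgue" "b \<in> borel_measurable lebesgue"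
    using aL bL by (auto simp: Linf_def)
  obtain a' A where a': "a' \<in> borel_measurable borel" "\<And>x. norm (a' x) \<le> A" and aa': "AE x in lebesgue. a x = a' x"
    using Linf_borel_representative[OF aL] by blast
  obtain b' B where b': "b' \<in> borel_measurable borel" "\<And>x. norm (b' x) \<le> B" and bb': "AE x in lebesgue. b x = b' x"
    using Linf_borel_representative[OF bL] by blast
  have [measurable]: "a' \<in> borel_measurable lebesgue" "b' \<in> borel_measurable lebesgue"
    using a' b' by (auto intro: measurable_completion)
  have Na: "mult_norm_enn \<rho> a = mult_norm_enn \<rho> a'" and Nb: "mult_norm_enn \<rho> b = mult_norm_enn \<rho> b'"
    by (intro mult_norm_enn_cong_AE aa' bb'; measurable)+
  have Nadd: "mult_norm_enn \<rho> (\<lambda>\<xi>. a \<xi> + b \<xi>) = mult_norm_enn \<rho> (\<lambda>\<xi>. a' \<xi> + b' \<xi>)"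
    by (rule mult_norm_enn_cong_AE) (use aa' bb' in auto)
  have Nmult: "mult_norm_enn \<rho> (\<lambda>\<xi>. a \<xi> * b \<xi>) = mult_norm_enn \<rho> (\<lambda>\<xi>. a' \<xi> * b' \<xi>)"
    by (rule mult_norm_enn_cong_AE) (use aa' bb' in auto)
  have Nscale: "mult_norm_enn \<rho> (\<lambda>\<xi>. c * a \<xi>) = mult_norm_enn \<rho> (\<lambda>\<xi>. c * a' \<xi>)"
    by (rule mult_norm_enn_cong_AE) (use aa' in auto)
  note fin' = fin[unfolded Na Nb]
  have add: "mult_norm_enn \<rho> (\<lambda>\<xi>. a \<xi> + b \<xi>) \<le> mult_norm_enn \<rho> a + mult_norm_enn \<rho> b"
    unfolding Nadd Na Nb by (rule mult_norm_enn_add[OF \<rho> a' b' fin'])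
  have mult: "mult_norm_enn \<rho> (\<lambda>\<xi>. a \<xi> * b \<xi>) \<le> mult_norm_enn \<rho> a * mult_norm_enn \<rho> b"
    unfolding Nmult Na Nb by (rule mult_norm_enn_mult[OF \<rho> a' b' fin'])
  have scale: "mult_norm_enn \<rho> (\<lambda>\<xi>. c * a \<xi>) = ennreal (cmod c) * mult_norm_enn \<rho> a"
    unfolding Nscale Na by (rule mult_norm_enn_scale[OF \<rho> a'])
  obtain CA CB where CA: "AE x in lebesgue. cmod (a x) \<le> CA" and CB: "AE x in lebesgue. cmod (b x) \<le> CB"
    using aL bL by (auto simp: Linf_def)
  have L1: "(\<lambda>\<xi>. a \<xi> + b \<xi>) \<in> Linf"
  proof -
    have "AE x in lebesgue. cmod (a x + b x) \<le> CA + CB"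
      using CA CB by eventually_elim (rule order_trans[OF norm_triangle_ineq add_mono])
    then show ?thesis by (auto simp: Linf_def)
  qed
  have L2: "(\<lambda>\<xi>. c * a \<xi>) \<in> Linf"
  proof -
    have "AE x in lebesgue. cmod (c * a x) \<le> cmod c * CA"
      using CA by eventually_elim (simp add: norm_mult mult_left_mono)
    then show ?thesis by (auto simp: Linf_def)
  qed
  have L3: "(\<lambda>\<xi>. a \<xi> * b \<xi>) \<in> Linf"
  proof -
    have "AE x in lebesgue. cmod (a x * b x) \<le> CA * CB"
      using CA CB
    proof eventually_elim
      case (elim x)
      then show ?case using order_trans[OF norm_ge_zero elim(1)] by (auto simp: norm_mult intro!: mult_mono)
    qed
    then show ?thesis by (auto simp: Linf_def)
  qed
  \<comment> \<open>Since \<open>enn2real\<close> sends infinity to 0, an inequality descends to the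
    real norms only once its upper bound is known to be finite.\<close>
  have f1: "mult_norm_enn \<rho> a + mult_norm_enn \<rho> b < top" using fin by simp
  have f2: "mult_norm_enn \<rho> a * mult_norm_enn \<rho> b < top" using fin by (simp add: ennreal_mult_less_top)
  have f3: "ennreal (cmod c) * mult_norm_enn \<rho> a < top" using fin by (simp add: ennreal_mult_less_top)
  have M: "(\<lambda>\<xi>. a \<xi> + b \<xi>) \<in> multipliers \<rho>" "(\<lambda>\<xi>. c * a \<xi>) \<in> multipliers \<rho>" "(\<lambda>\<xi>. a \<xi> * b \<xi>) \<in> multipliers \<rho>"
    using add mult scale f1 f2 f3 by (auto simp: multipliers_def intro: order_le_less_trans)
  have m1: "mult_norm \<rho> (\<lambda>\<xi>. a \<xi> + b \<xi>) \<le> mult_norm \<rho> a + mult_norm \<rho> b"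
    using enn2real_mono[OF add f1] fin by (simp add: mult_norm_def enn2real_plus)
  have m2: "mult_norm \<rho> (\<lambda>\<xi>. a \<xi> * b \<xi>) \<le> mult_norm \<rho> a * mult_norm \<rho> b"
    using enn2real_mono[OF mult f2] by (simp add: mult_norm_def enn2real_mult)
  have m3: "mult_norm \<rho> (\<lambda>\<xi>. c * a \<xi>) = cmod c * mult_norm \<rho> a"
    by (simp add: mult_norm_def scale enn2real_mult)
  have m4: "mult_norm \<rho> a = 0 \<longleftrightarrow> (AE \<xi> in lebesgue. a \<xi> = 0)"
  proof
    assume "mult_norm \<rho> a = 0"
    then have "mult_norm_enn \<rho> a' = 0"
      using fin Na by (auto simp: mult_norm_def enn2real_eq_0_iff)
    then have "AE x in lborel. a' x = 0" by (rule mult_norm_enn_eq_0_imp[OF \<rho> a'])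
    then have "AE x in lebesgue. a' x = 0" by (rule AE_completion)
    with aa' show "AE x in lebesgue. a x = 0" by eventually_elim simp
  next
    assume "AE x in lebesgue. a x = 0"
    \<comment> \<open>An almost everywhere vanishing symbol agrees almost everywhere with 0 times
      itself, so homogeneity with the scalar 0 finishes the argument.\<close>
    then have "mult_norm_enn \<rho> a = mult_norm_enn \<rho> (\<lambda>x. 0 * a x)"
      by (intro mult_norm_enn_cong_AE) auto
    also have "\<dots> = mult_norm_enn \<rho> (\<lambda>x. 0 * a' x)" by simp
    also have "\<dots> = 0" using mult_norm_enn_scale[OF \<rho> a', of 0] by simp
    finally show "mult_norm \<rho> a = 0" by (simp add: mult_norm_def)
  qed
  show "(\<lambda>\<xi>. a \<xi> + b \<xi>) \<in> multipliers \<rho> \<inter> Linf \<and>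
           (\<lambda>\<xi>. c * a \<xi>) \<in> multipliers \<rho> \<inter> Linf \<and>
           (\<lambda>\<xi>. a \<xi> * b \<xi>) \<in> multipliers \<rho> \<inter> Linf \<and>
           mult_norm \<rho> (\<lambda>\<xi>. a \<xi> + b \<xi>) \<le> mult_norm \<rho> a + mult_norm \<rho> b \<and>
           mult_norm \<rho> (\<lambda>\<xi>. c * a \<xi>) = cmod c * mult_norm \<rho> a \<and>
           (mult_norm \<rho> a = 0 \<longleftrightarrow> (AE \<xi> in lebesgue. a \<xi> = 0)) \<and>
           mult_norm \<rho> (\<lambda>\<xi>. a \<xi> * b \<xi>) \<le> mult_norm \<rho> a * mult_norm \<rho> b"
    using M L1 L2 L3 m1 m2 m3 m4 by blast
qed

end
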